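(* Let $\mathcal{H}_A,\mathcal{H}_B,\mathcal{H}_a,\mathcal{H}_b$ be finite-dimensional complex Hilbert spaces, let $\mathcal{U}$ be a unitary operator on $\mathcal{H}_A\otimes\mathcal{H}_B$, and let $|\Phi\rangle\in\mathcal{H}_a\otimes\mathcal{H}_b$ be a normalized state. Suppose that $\mathcal{U}$ can be generated using the entangled resource $|\Phi\rangle$ and a separable quantum operation. Then the Schmidt rank of $|\Phi\rangle$ (with respect to $\mathcal{H}_a\otimes\mathcal{H}_b$) is not less than the Schmidt rank of $\mathcal{U}$ (with respect to $\mathcal{H}_A\otimes\mathcal{H}_B$), and the entanglement of $|\Phi\rangle$ is not less than the entangling strength of $\mathcal{U}$.
   Context: Generating $\mathcal{U}$ by a separable operation with resource $|\Phi\rangle$: there are finitely many pairs of operators $E_m:\mathcal{H}_a\otimes\mathcal{H}_A\to\mathcal{H}_A$ and $F_m:\mathcal{H}_b\otimes\mathcal{H}_B\to\mathcal{H}_B$ with $\sum_m E_m^\dagger E_m\otimes F_m^\dagger F_m=I_{aA}\otimes I_{bB}$, and complex numbers $c_m$, such that for every $m$ and every $|\Psi\rangle\in\mathcal{H}_A\otimes\mathcal{H}_B$, $$(E_m\otimes F_m)\big(|\Phi\rangle_{ab}\otimes|\Psi\rangle_{AB}\big)=c_m\,\mathcal{U}|\Psi\rangle_{AB}$$ (tensor factors being reordered in the obvious way). Operations consisting of local operations and classical communication (LOCC) are special cases of separable operations. Schmidt rank of an operator on $\mathcal{H}_A\otimes\mathcal{H}_B$: the minimum number of terms in an expansion of the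 operator as a sum of products $A_j\otimes B_j$ of operators on the separate systems. The Schmidt rank of a bipartite pure state is defined analogously with product vectors. Entanglement of a normalized bipartite pure state: $-\sum_j\lambda_j\log\lambda_j$, where $\lambda_j$ are the squares of its Schmidt coefficients (so $\sum_j\lambda_j=1$). Entangling strength of $\mathcal{U}$: the maximum, over finite-dimensional ancillary systems $\bar A,\bar B$ and normalized (possibly entangled) states $|\sigma\rangle\in\mathcal{H}_A\otimes\mathcal{H}_{\bar A}$, $|\tau\rangle\in\mathcal{H}_B\otimes\mathcal{H}_{\bar B}$, of the entanglement, with respect to the bipartition $A\bar A\,|\,B\bar B$, of the state $(\mathcal{U}\otimes I_{\bar A}\otimes I_{\bar B})(|\sigma\rangle\otimes|\tau\rangle)$. *)

theory Defs
  imports "Jordan_Normal_Form.Schur_Decomposition" "HOL-Library.Extended_Real"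
begin

text \<open>
  Finite-dimensional Hilbert spaces are coordinatised: a space of dimension n is
  \<^term>\<open>carrier_vec n :: complex vec set\<close> with the inner product \<open>\<bullet>c\<close>, and the tensor product
  of spaces of dimensions n and m has dimension \<open>n * m\<close>, the product basis vector
  \<open>e\<^sub>i \<otimes> e\<^sub>j\<close> having index \<open>i * m + j\<close>.
\<close>

definition tensor_vec :: "complex vec \<Rightarrow> complex vec \<Rightarrow> complex vec" where
  "tensor_vec v w =
     vec (dim_vec v * dim_vec w) (\<lambda>k. v $ (k div dim_vec w) * w $ (k mod dim_vec w))"

definition tensor_mat :: "complex mat \<Rightarrow> complex mat \<Rightarrow> complex mat" where
  "tensor_mat A B =
     mat (dim_row A * dim_row B) (dim_col A * dim_col B)
       (\<lambda>(i, j). A $$ (i div dim_row B, j div dim_col B) * B $$ (i mod dim_row B, j mod dim_col B))"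

definition mat_sum :: "nat \<Rightarrow> nat \<Rightarrow> ('i \<Rightarrow> complex mat) \<Rightarrow> 'i set \<Rightarrow> complex mat" where
  "mat_sum nr nc A I = mat nr nc (\<lambda>ij. \<Sum>m\<in>I. A m $$ ij)"

text \<open>
  The canonical isomorphism from \<open>(H\<^sub>1 \<otimes> H\<^sub>2) \<otimes> (H\<^sub>3 \<otimes> H\<^sub>4)\<close> to \<open>(H\<^sub>1 \<otimes> H\<^sub>3) \<otimes> (H\<^sub>2 \<otimes> H\<^sub>4)\<close>,
  where the i-th space has dimension \<open>n\<^sub>i\<close>. The output index k encodes
  \<open>(i\<^sub>1, i\<^sub>3, i\<^sub>2, i\<^sub>4)\<close> in mixed radix.
\<close>

definition swap_middle :: "nat \<Rightarrow> nat \<Rightarrow> nat \<Rightarrow> nat \<Rightarrow> complex vec \<Rightarrow> complex vec" where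
  "swap_middle n1 n2 n3 n4 v =
     vec (n1 * n3 * (n2 * n4))
       (\<lambda>k. let i4 = k mod n4; i2 = k div n4 mod n2;
                i3 = k div (n2 * n4) mod n3; i1 = k div (n2 * n4) div n3
            in v $ ((i1 * n2 + i2) * (n3 * n4) + (i3 * n4 + i4)))"

lemma swap_middle_tensor_vec:
  assumes "u \<in> carrier_vec n1" "v \<in> carrier_vec n2" "w \<in> carrier_vec n3" "x \<in> carrier_vec n4"
  shows "swap_middle n1 n2 n3 n4 (tensor_vec (tensor_vec u v) (tensor_vec w x)) =
         tensor_vec (tensor_vec u w) (tensor_vec v x)"
proof (rule eq_vecI)
  have d: "dim_vec u = n1" "dim_vec v = n2" "dim_vec w = n3" "dim_vec x = n4"
    using assms by auto
  show "dim_vec (swap_middle n1 n2 n3 n4 (tensor_vec (tensor_vec u v) (tensor_vec w x))) =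
        dim_vec (tensor_vec (tensor_vec u w) (tensor_vec v x))"
    by (simp add: swap_middle_def tensor_vec_def d)
  fix k assume "k < dim_vec (tensor_vec (tensor_vec u w) (tensor_vec v x))"
  then have k: "k < n1 * n3 * (n2 * n4)" by (simp add: tensor_vec_def d)
  then have pos: "n1 > 0" "n2 > 0" "n3 > 0" "n4 > 0" by (auto intro: gr0I)
  define i4 where "i4 = k mod n4"
  define i2 where "i2 = k div n4 mod n2"
  define i3 where "i3 = k div (n2 * n4) mod n3"
  define i1 where "i1 = k div (n2 * n4) div n3"
  have q: "k div (n2 * n4) < n1 * n3"
    using k by (simp add: less_mult_imp_div_less)
  have b: "i1 < n1" "i2 < n2" "i3 < n3" "i4 < n4"
    using pos q by (auto simp: i1_def i2_def i3_def i4_def less_mult_imp_div_less)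
  have r: "k mod (n2 * n4) < n2 * n4" using pos by simp
  have rd: "k mod (n2 * n4) div n4 = i2"
    unfolding i2_def using pos by (simp add: mult.commute[of n2] mod_mult2_eq)
  have rm: "k mod (n2 * n4) mod n4 = i4"
    unfolding i4_def by (simp add: mod_mod_cancel)
  have bound: "a * m + b < n * m" if "a < n" "b < m" for a b n m :: nat
  proof -
    have "a * m + b < Suc a * m" using that by simp
    also have "Suc a * m \<le> n * m" using that by (intro mult_le_mono1) simp
    finally show ?thesis .
  qed
  have c12: "i1 * n2 + i2 < n1 * n2" and c34: "i3 * n4 + i4 < n3 * n4"
    using b by (auto intro: bound)
  have "(i1 * n2 + i2) * (n3 * n4) + (i3 * n4 + i4) < n1 * n2 * (n3 * n4)"
    using c12 c34 by (rule bound)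
  then show "swap_middle n1 n2 n3 n4 (tensor_vec (tensor_vec u v) (tensor_vec w x)) $ k =
        tensor_vec (tensor_vec u w) (tensor_vec v x) $ k"
    using k b c12 c34 q r rd rm
    by (simp add: swap_middle_def tensor_vec_def d Let_def flip: i1_def i2_def i3_def i4_def)
qed

definition unitary_mat :: "nat \<Rightarrow> complex mat \<Rightarrow> bool" where
  "unitary_mat n U \<longleftrightarrow>
     U \<in> carrier_mat n n \<and> mat_adjoint U * U = 1\<^sub>m n \<and> U * mat_adjoint U = 1\<^sub>m n"

definition normalized_state :: "nat \<Rightarrow> complex vec \<Rightarrow> bool" where
  "normalized_state n v \<longleftrightarrow> v \<in> carrier_vec n \<and> v \<bullet>c v = 1"

definition generated_by_separable ::
  "nat \<Rightarrow> nat \<Rightarrow> nat \<Rightarrow> nat \<Rightarrow> complex vec \<Rightarrow> complex mat \<Rightarrow> bool" where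
  "generated_by_separable da db dA dB \<Phi> U \<longleftrightarrow>
     (\<exists>(M :: nat) E F (c :: nat \<Rightarrow> complex).
        (\<forall>m<M. E m \<in> carrier_mat dA (da * dA) \<and> F m \<in> carrier_mat dB (db * dB)) \<and>
        mat_sum (da * dA * (db * dB)) (da * dA * (db * dB))
          (\<lambda>m. tensor_mat (mat_adjoint (E m) * E m) (mat_adjoint (F m) * F m)) {..<M}
          = tensor_mat (1\<^sub>m (da * dA)) (1\<^sub>m (db * dB)) \<and>
        (\<forall>m<M. \<forall>\<Psi>\<in>carrier_vec (dA * dB).
           tensor_mat (E m) (F m) *\<^sub>v swap_middle da db dA dB (tensor_vec \<Phi> \<Psi>)
           = c m \<cdot>\<^sub>v (U *\<^sub>v \<Psi>)))"

definition schmidt_rank_op :: "nat \<Rightarrow> nat \<Rightarrow> complex mat \<Rightarrow> nat" where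
  "schmidt_rank_op dA dB U =
     (LEAST r. \<exists>A B. (\<forall>j<r. A j \<in> carrier_mat dA dA \<and> B j \<in> carrier_mat dB dB) \<and>
        U = mat_sum (dA * dB) (dA * dB) (\<lambda>j. tensor_mat (A j) (B j)) {..<r})"

definition schmidt_rank_state :: "nat \<Rightarrow> nat \<Rightarrow> complex vec \<Rightarrow> nat" where
  "schmidt_rank_state n m \<psi> =
     (LEAST r. \<exists>v w. (\<forall>j<r. v j \<in> carrier_vec n \<and> w j \<in> carrier_vec m) \<and>
        \<psi> = finsum_vec TYPE(complex) (n * m) (\<lambda>j. tensor_vec (v j) (w j)) {..<r})"

definition orthonormal_list :: "nat \<Rightarrow> complex vec list \<Rightarrow> bool" where
  "orthonormal_list n vs \<longleftrightarrow> set vs \<subseteq> carrier_vec n \<and>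
     (\<forall>i<length vs. \<forall>j<length vs. vs ! i \<bullet>c vs ! j = (if i = j then 1 else 0))"

definition schmidt_decomposition ::
  "nat \<Rightarrow> nat \<Rightarrow> complex vec \<Rightarrow> real list \<Rightarrow> complex vec list \<Rightarrow> complex vec list \<Rightarrow> bool" where
  "schmidt_decomposition n m \<psi> s e f \<longleftrightarrow>
     length e = length s \<and> length f = length s \<and> (\<forall>x\<in>set s. x > 0) \<and>
     orthonormal_list n e \<and> orthonormal_list m f \<and>
     \<psi> = finsum_vec TYPE(complex) (n * m)
           (\<lambda>j. complex_of_real (s ! j) \<cdot>\<^sub>v tensor_vec (e ! j) (f ! j)) {..<length s}"

text \<open>
  Every vector has a Schmidt decomposition, and the list of its (positive) coefficients is unique
  up to order; the entanglement does not depend on that order, nor on the omitted zero coefficients.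
\<close>

definition schmidt_coeffs :: "nat \<Rightarrow> nat \<Rightarrow> complex vec \<Rightarrow> real list" where
  "schmidt_coeffs n m \<psi> = (SOME s. \<exists>e f. schmidt_decomposition n m \<psi> s e f)"

text \<open>
  Entropies are in natural units; another base of the logarithm larger than 1 only rescales
  both \<open>entanglement\<close> and \<open>entangling_strength\<close> by the same positive factor.
\<close>

definition entanglement :: "nat \<Rightarrow> nat \<Rightarrow> complex vec \<Rightarrow> real" where
  "entanglement n m \<psi> = - (\<Sum>s\<leftarrow>schmidt_coeffs n m \<psi>. s\<^sup>2 * ln (s\<^sup>2))"

text \<open>
  With ancillas of dimensions p and q, the product \<open>\<sigma> \<otimes> \<tau>\<close> lies in \<open>(A \<otimes> A') \<otimes> (B \<otimes> B')\<close>. It is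
  reordered to \<open>(A \<otimes> B) \<otimes> (A' \<otimes> B')\<close>, where \<open>U \<otimes> I \<otimes> I\<close> acts, and then reordered back.
  The supremum is taken in the extended reals, so that an upper bound on it bounds
  every entanglement in the set (the real-valued supremum of an unbounded set is unspecified).
\<close>

definition output_state ::
  "nat \<Rightarrow> nat \<Rightarrow> nat \<Rightarrow> nat \<Rightarrow> complex mat \<Rightarrow> complex vec \<Rightarrow> complex vec \<Rightarrow> complex vec" where
  "output_state dA dB p q U \<sigma> \<tau> =
     swap_middle dA dB p q
       (tensor_mat U (tensor_mat (1\<^sub>m p) (1\<^sub>m q)) *\<^sub>v swap_middle dA p dB q (tensor_vec \<sigma> \<tau>))"

definition entangling_strength :: "nat \<Rightarrow> nat \<Rightarrow> complex mat \<Rightarrow> ereal" where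
  "entangling_strength dA dB U =
     Sup {ereal (entanglement (dA * p) (dB * q) (output_state dA dB p q U \<sigma> \<tau>)) | p q \<sigma> \<tau>.
            normalized_state (dA * p) \<sigma> \<and> normalized_state (dB * q) \<tau>}"

end

theory Submission
  imports Defs "Jordan_Normal_Form.Spectral_Radius"
begin

text \<open>
  Write \<open>K\<^sub>m = E\<^sub>m \<otimes> F\<^sub>m\<close>, so that \<open>\<Sum>\<^sub>m K\<^sub>m\<^sup>\<dagger> K\<^sub>m = I\<close> and \<open>K\<^sub>m \<chi> = c\<^sub>m \<omega>\<close>, where \<open>\<chi>\<close> is the resource together
  with the product input and \<open>\<omega>\<close> is the output of \<open>U\<close>; then \<open>\<Sum>\<^sub>m |c\<^sub>m|\<^sup>2 = 1\<close>.
  Inserting a product expansion of the resource into a branch with \<open>c\<^sub>m \<noteq> 0\<close> expands \<open>U\<close> with equally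
  many product terms, which gives the claim on Schmidt ranks.

  For the entanglement, let \<open>\<phi>\<close> consist of the Schmidt terms of \<open>\<chi>\<close> with squared coefficient above a
  threshold \<open>\<theta>\<close>. Then \<open>\<langle>\<phi>, \<chi>\<rangle> = \<Sum>\<^sub>m c\<^sub>m \<langle>K\<^sub>m \<phi>, \<omega>\<rangle>\<close>, and each \<open>K\<^sub>m \<phi>\<close> has at most the Schmidt rank of \<open>\<phi>\<close>, which
  bounds its overlap with \<open>\<omega>\<close> in terms of the Schmidt coefficients of \<open>\<omega>\<close>. By Cauchy-Schwarz over \<open>m\<close>,
  the squared Schmidt coefficients x of \<open>\<chi>\<close> (which are those of the resource) and y of \<open>\<omega>\<close> satisfy
  \<open>\<Sum> max 0 (x - \<theta>) \<le> \<Sum> max 0 (y - \<theta>)\<close> for every \<open>\<theta> \<ge> 0\<close>. That is majorization, and it implies the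
  inequality of entropies because \<open>- x ln x + x\<close> is the integral over [0, 1] of \<open>min x \<theta> / \<theta>\<close>.
\<close>

section \<open>Orthonormal families of functions on a finite set\<close>

text \<open>Vectors are functions on an arbitrary index set, so that one set of lemmas serves local
  indices, pairs \<open>I \<times> J\<close> and the branches \<open>{..<M}\<close>. The first
  argument is conjugated, whereas \<open>\<bullet>c\<close> conjugates the second.\<close>

definition ip :: "'a set \<Rightarrow> ('a \<Rightarrow> complex) \<Rightarrow> ('a \<Rightarrow> complex) \<Rightarrow> complex" where
  "ip I u v = (\<Sum>i\<in>I. cnj (u i) * v i)"

definition nrm2 :: "'a set \<Rightarrow> ('a \<Rightarrow> complex) \<Rightarrow> real" where
  "nrm2 I u = (\<Sum>i\<in>I. (cmod (u i))\<^sup>2)"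

definition orthonormal_on :: "'a set \<Rightarrow> nat \<Rightarrow> (nat \<Rightarrow> 'a \<Rightarrow> complex) \<Rightarrow> bool" where
  "orthonormal_on I d u \<longleftrightarrow> (\<forall>k<d. \<forall>l<d. ip I (u k) (u l) = (if k = l then 1 else 0))"

text \<open>Membership of \<open>v\<close> in the span of the family is expressed as
  \<open>v i = proj_on I d u v i\<close> for all \<open>i \<in> I\<close>, an equality asked on
  \<open>I\<close> only.\<close>

definition proj_on :: "'a set \<Rightarrow> nat \<Rightarrow> (nat \<Rightarrow> 'a \<Rightarrow> complex) \<Rightarrow> ('a \<Rightarrow> complex) \<Rightarrow> 'a \<Rightarrow> complex" where
  "proj_on I d u v i = (\<Sum>k<d. ip I (u k) v * u k i)"

lemma ip_self: "ip I u u = of_real (nrm2 I u)"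
  unfolding ip_def nrm2_def of_real_sum
  by (intro sum.cong refl) (metis complex_norm_square mult.commute)

lemma nrm2_nonneg: "nrm2 I u \<ge> 0"
  unfolding nrm2_def by (intro sum_nonneg) auto

lemma nrm2_eq_0_iff: "finite I \<Longrightarrow> nrm2 I u = 0 \<longleftrightarrow> (\<forall>i\<in>I. u i = 0)"
  unfolding nrm2_def by (subst sum_nonneg_eq_0_iff) auto

lemma cnj_ip: "cnj (ip I u v) = ip I v u"
  unfolding ip_def by (simp add: mult.commute)

lemma ip_cong: "(\<And>i. i \<in> I \<Longrightarrow> u i = u' i) \<Longrightarrow> (\<And>i. i \<in> I \<Longrightarrow> v i = v' i) \<Longrightarrow> ip I u v = ip I u' v'"
  unfolding ip_def by (intro sum.cong) auto

lemma nrm2_cong: "(\<And>i. i \<in> I \<Longrightarrow> u i = u' i) \<Longrightarrow> nrm2 I u = nrm2 I u'"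
  unfolding nrm2_def by (intro sum.cong) auto

lemma ip_sum_right: "ip I u (\<lambda>i. \<Sum>k\<in>K. c k * v k i) = (\<Sum>k\<in>K. c k * ip I u (v k))"
  unfolding ip_def sum_distrib_left by (subst sum.swap) (simp add: mult_ac)

lemma ip_sum_left: "ip I (\<lambda>i. \<Sum>k\<in>K. c k * u k i) v = (\<Sum>k\<in>K. cnj (c k) * ip I (u k) v)"
  unfolding ip_def sum_distrib_left cnj_sum sum_distrib_right
  by (subst sum.swap) (simp add: mult_ac)

lemma ip_diff_right: "ip I u (\<lambda>i. v i - w i) = ip I u v - ip I u w"
  unfolding ip_def by (simp add: algebra_simps sum_subtractf)

lemma ip_scale_right: "ip I u (\<lambda>i. c * v i) = c * ip I u v"
  unfolding ip_def by (simp add: sum_distrib_left mult_ac)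

lemma ip_scale_left: "ip I (\<lambda>i. c * u i) v = cnj c * ip I u v"
  unfolding ip_def by (simp add: sum_distrib_left mult_ac)

lemma orthonormal_onD:
  "orthonormal_on I d u \<Longrightarrow> k < d \<Longrightarrow> l < d \<Longrightarrow> ip I (u k) (u l) = (if k = l then 1 else 0)"
  unfolding orthonormal_on_def by blast

lemma orthonormal_on_nrm2: "orthonormal_on I d u \<Longrightarrow> k < d \<Longrightarrow> nrm2 I (u k) = 1"
  using orthonormal_onD[of I d u k k] by (simp add: ip_self)

lemma ip_orthonormal_sum:
  assumes "orthonormal_on I d u" "l < d"
  shows "ip I (u l) (\<lambda>i. \<Sum>k<d. c k * u k i) = c l"
proof -
  have "(\<Sum>k<d. c k * ip I (u l) (u k)) = (\<Sum>k<d. if l = k then c k else 0)"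
    using assms by (intro sum.cong) (auto simp: orthonormal_onD)
  then show ?thesis using assms(2) by (simp add: ip_sum_right)
qed

lemma nrm2_orthonormal_sum:
  assumes "orthonormal_on I d u"
  shows "nrm2 I (\<lambda>i. \<Sum>k<d. c k * u k i) = (\<Sum>k<d. (cmod (c k))\<^sup>2)"
proof -
  have "complex_of_real (nrm2 I (\<lambda>i. \<Sum>k<d. c k * u k i)) = (\<Sum>k<d. cnj (c k) * c k)"
    unfolding ip_self[symmetric] ip_sum_left
    by (intro sum.cong refl) (simp only: ip_orthonormal_sum[OF assms] lessThan_iff)
  also have "\<dots> = complex_of_real (\<Sum>k<d. (cmod (c k))\<^sup>2)"
    unfolding of_real_sum by (intro sum.cong refl) (metis complex_norm_square mult.commute)
  finally show ?thesis using of_real_eq_iff by blast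
qed

lemma ip_proj_on: "orthonormal_on I d u \<Longrightarrow> k < d \<Longrightarrow> ip I (u k) (proj_on I d u v) = ip I (u k) v"
  unfolding proj_on_def[abs_def] by (rule ip_orthonormal_sum)

lemma nrm2_diff_proj_on:
  assumes "orthonormal_on I d u"
  shows "nrm2 I (\<lambda>i. v i - proj_on I d u v i) = nrm2 I v - (\<Sum>k<d. (cmod (ip I (u k) v))\<^sup>2)"
proof -
  let ?p = "proj_on I d u v"
  have vp: "ip I v ?p = (\<Sum>k<d. of_real ((cmod (ip I (u k) v))\<^sup>2))"
    unfolding proj_on_def[abs_def] ip_sum_right
    by (intro sum.cong refl) (metis cnj_ip complex_norm_square)
  have pp: "ip I ?p ?p = (\<Sum>k<d. of_real ((cmod (ip I (u k) v))\<^sup>2))"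
    unfolding ip_self proj_on_def[abs_def] nrm2_orthonormal_sum[OF assms] by simp
  have "ip I ?p v = cnj (ip I v ?p)" by (simp add: cnj_ip)
  then have pv: "ip I ?p v = (\<Sum>k<d. of_real ((cmod (ip I (u k) v))\<^sup>2))" unfolding vp by simp
  have "ip I (\<lambda>i. v i - ?p i) (\<lambda>i. v i - ?p i) = ip I v v - ip I v ?p - (ip I ?p v - ip I ?p ?p)"
    unfolding ip_def by (simp add: algebra_simps sum_subtractf sum.distrib)
  also have "\<dots> = complex_of_real (nrm2 I v - (\<Sum>k<d. (cmod (ip I (u k) v))\<^sup>2))"
    unfolding pp vp pv by (simp add: ip_self)
  finally show ?thesis unfolding ip_self of_real_eq_iff .
qed

lemma bessel:
  assumes "orthonormal_on I d u"
  shows "(\<Sum>k<d. (cmod (ip I (u k) v))\<^sup>2) \<le> nrm2 I v"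
  using nrm2_diff_proj_on[OF assms, of v] nrm2_nonneg[of I "\<lambda>i. v i - proj_on I d u v i"] by linarith

text \<open>Bessel's inequality for the one-element family consisting of the normalized
  \<open>u\<close>; a vanishing \<open>u\<close> cannot be normalized and is treated apart.\<close>

lemma ip_cauchy_schwarz:
  assumes "finite I"
  shows "(cmod (ip I u v))\<^sup>2 \<le> nrm2 I u * nrm2 I v"
proof (cases "nrm2 I u = 0")
  case True
  then have "ip I u v = 0" using assms by (simp add: nrm2_eq_0_iff ip_def)
  then show ?thesis using True by simp
next
  case False
  define N where "N = nrm2 I u"
  have N: "N > 0" using False nrm2_nonneg[of I u] by (simp add: N_def)
  define c where "c = complex_of_real (1 / sqrt N)"
  define w where "w = (\<lambda>k::nat. \<lambda>i. c * u i)"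
  have c: "cnj c = c" "c * (c * complex_of_real N) = 1"
    using N by (simp_all add: c_def flip: of_real_mult)
  have cN: "(cmod c)\<^sup>2 = 1 / N"
    unfolding c_def norm_of_real power2_abs using N by (simp add: power_divide)
  have "orthonormal_on I 1 w"
    by (simp add: orthonormal_on_def w_def ip_scale_left ip_scale_right ip_self c flip: N_def)
  then have "(cmod (ip I (w 0) v))\<^sup>2 \<le> nrm2 I v" using bessel[of I 1 w v] by simp
  moreover have "(cmod (ip I (w 0) v))\<^sup>2 = (cmod (ip I u v))\<^sup>2 / N"
    by (simp add: w_def ip_scale_left norm_mult power_mult_distrib c(1) cN)
  ultimately show ?thesis using N by (simp add: N_def field_simps)
qed

section \<open>Gram-Schmidt orthonormalization and completion to a basis\<close>

text \<open>One Gram-Schmidt step: the residual of \<open>v\<close>, divided by its norm, is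
  appended unless it vanishes on \<open>I\<close>.\<close>

lemma orthonormal_on_extend1:
  assumes I: "finite I" and u: "orthonormal_on I d u"
  shows "\<exists>d' u'. d \<le> d' \<and> d' \<le> Suc d \<and> (\<forall>k<d. u' k = u k) \<and> orthonormal_on I d' u' \<and>
           (\<forall>i\<in>I. v i = proj_on I d' u' v i)"
proof (cases "\<forall>i\<in>I. v i = proj_on I d u v i")
  case True
  then show ?thesis using u by (intro exI[of _ d] exI[of _ u]) auto
next
  case False
  define w where "w = (\<lambda>i. v i - proj_on I d u v i)"
  define N where "N = nrm2 I w"
  have "N \<noteq> 0" using False I by (auto simp: N_def w_def nrm2_eq_0_iff)
  then have N: "N > 0" using nrm2_nonneg[of I w] by (simp add: N_def)
  define c where "c = complex_of_real (1 / sqrt N)"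
  have c: "cnj c = c" "c * (c * complex_of_real N) = 1"
    using N by (simp_all add: c_def flip: of_real_mult)
  define e where "e = (\<lambda>i. c * w i)"
  define u' where "u' = u(d := e)"
  have uw: "ip I (u k) w = 0" if "k < d" for k
    using that u by (simp add: w_def ip_diff_right ip_proj_on)
  have wu: "ip I w (u k) = 0" if "k < d" for k
    using uw[OF that] cnj_ip[of I "u k" w] by simp
  have ee: "ip I e e = 1"
    unfolding e_def ip_scale_left ip_scale_right ip_self[of I w] N_def[symmetric] by (simp add: c)
  have ue: "ip I (u k) e = 0" "ip I e (u k) = 0" if "k < d" for k
    using uw[OF that] wu[OF that] by (auto simp: e_def ip_scale_left ip_scale_right)
  have o: "orthonormal_on I (Suc d) u'"
    unfolding orthonormal_on_def
  proof (intro allI impI)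
    fix k l assume "k < Suc d" "l < Suc d"
    then show "ip I (u' k) (u' l) = (if k = l then 1 else 0)"
      using u ee ue[of k] ue[of l] by (cases "k = d"; cases "l = d") (auto simp: u'_def orthonormal_onD)
  qed
  have wp: "ip I w (proj_on I d u v) = 0"
    unfolding proj_on_def[abs_def] ip_sum_right by (intro sum.neutral) (auto simp: wu)
  \<comment> \<open>The residual \<open>w\<close> is orthogonal to the projection, so its inner
    product with \<open>v\<close> is its own squared norm \<open>N\<close>. Hence the component of
    \<open>v\<close> along the normalized residual \<open>e\<close> is \<open>w\<close>
    itself.\<close>
  have "ip I w v = ip I w w + ip I w (proj_on I d u v)"
    unfolding ip_def w_def by (simp add: algebra_simps sum_subtractf sum.distrib)
  then have wv: "ip I w v = of_real N" by (simp add: wp ip_self N_def)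
  have "v i = proj_on I (Suc d) u' v i" for i
  proof -
    have "proj_on I (Suc d) u' v i = proj_on I d u v i + ip I e v * e i"
      by (simp add: proj_on_def u'_def)
    also have "ip I e v * e i = (c * (c * complex_of_real N)) * w i"
      by (simp add: e_def ip_scale_left wv c(1))
    also have "\<dots> = w i" unfolding c by simp
    finally show ?thesis by (simp add: w_def)
  qed
  then show ?thesis using o by (intro exI[of _ "Suc d"] exI[of _ u']) (auto simp: u'_def)
qed

text \<open>Each appended vector is orthogonal to the old family, hence to \<open>v\<close>, which
  lies in its span; so the new terms of the projection vanish.\<close>

lemma proj_on_extend:
  assumes u: "orthonormal_on I d u" and u': "orthonormal_on I d' u'" and d: "d \<le> d'"
    and eq: "\<forall>k<d. u' k = u k" and v: "\<forall>i\<in>I. v i = proj_on I d u v i"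
  shows "\<forall>i\<in>I. v i = proj_on I d' u' v i"
proof
  fix i assume i: "i \<in> I"
  have "ip I (u' k) v = 0" if "k < d'" "\<not> k < d" for k
  proof -
    have "ip I (u' k) v = ip I (u' k) (proj_on I d u v)" using v by (intro ip_cong) auto
    also have "\<dots> = (\<Sum>l<d. ip I (u l) v * ip I (u' k) (u' l))"
      unfolding proj_on_def[abs_def] ip_sum_right using eq by (intro sum.cong) auto
    also have "\<dots> = 0" using that d u' by (intro sum.neutral) (auto simp: orthonormal_onD)
    finally show ?thesis .
  qed
  then have "proj_on I d' u' v i = (\<Sum>k\<in>{..<d}. ip I (u' k) v * u' k i)"
    unfolding proj_on_def using d by (intro sum.mono_neutral_right) auto
  also have "\<dots> = proj_on I d u v i" unfolding proj_on_def using eq by (intro sum.cong) auto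
  finally show "v i = proj_on I d' u' v i" using v i by simp
qed

text \<open>The single step applied to each \<open>a k\<close> in turn. Through the bound
  \<open>d' \<le> d + card K\<close>, the number of product terms of a vector limits the dimension
  of its local support in \<open>overlap_bound\<close>.\<close>

lemma gram_schmidt_on:
  assumes I: "finite I" and K: "finite K" and u: "orthonormal_on I d u"
  shows "\<exists>d' u'. d \<le> d' \<and> d' \<le> d + card K \<and> (\<forall>k<d. u' k = u k) \<and> orthonormal_on I d' u' \<and>
           (\<forall>k\<in>K. \<forall>i\<in>I. a k i = proj_on I d' u' (a k) i)"
  using K
proof (induction K rule: finite_induct)
  case empty
  then show ?case using u by (intro exI[of _ d] exI[of _ u]) auto
next
  case (insert x K)
  then obtain d1 u1 where 1: "d \<le> d1" "d1 \<le> d + card K" "\<forall>k<d. u1 k = u k" "orthonormal_on I d1 u1"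
    "\<forall>k\<in>K. \<forall>i\<in>I. a k i = proj_on I d1 u1 (a k) i" by auto
  from orthonormal_on_extend1[OF I 1(4), of "a x"]
  obtain d2 u2 where 2: "d1 \<le> d2" "d2 \<le> Suc d1" "\<forall>k<d1. u2 k = u1 k" "orthonormal_on I d2 u2"
    "\<forall>i\<in>I. a x i = proj_on I d2 u2 (a x) i" by auto
  have "\<forall>i\<in>I. a k i = proj_on I d2 u2 (a k) i" if "k \<in> K" for k
    using proj_on_extend[OF 1(4) 2(4) 2(1) 2(3)] 1(5) that by blast
  then show ?case using 1 2 insert.hyps
    by (intro exI[of _ d2] exI[of _ u2]) auto
qed

text \<open>Gram-Schmidt is run on the indicator functions of the points of \<open>I\<close>; that
  all of them lie in the span is the resolution of the identity.\<close>

lemma orthonormal_on_complete: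
  fixes u :: "nat \<Rightarrow> 'a \<Rightarrow> complex"
  assumes I: "finite I" and u: "orthonormal_on I d u"
  shows "\<exists>u'. d \<le> card I \<and> (\<forall>k<d. u' k = u k) \<and> orthonormal_on I (card I) u' \<and>
           (\<forall>i\<in>I. \<forall>j\<in>I. (\<Sum>k<card I. u' k i * cnj (u' k j)) = (if i = j then 1 else 0))"
proof -
  define a where "a = (\<lambda>j i::'a. if i = j then 1 else 0 :: complex)"
  from gram_schmidt_on[OF I I u, of a]
  obtain d' u' where 1: "d \<le> d'" "\<forall>k<d. u' k = u k" "orthonormal_on I d' u'"
    "\<forall>k\<in>I. \<forall>i\<in>I. a k i = proj_on I d' u' (a k) i" by auto
  have ipa: "ip I v (a j) = cnj (v j)" if "j \<in> I" for v :: "'a \<Rightarrow> complex" and j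
  proof -
    have "ip I v (a j) = (\<Sum>i\<in>I. if i = j then cnj (v i) else 0)"
      unfolding ip_def a_def by (intro sum.cong) auto
    then show ?thesis using that I by simp
  qed
  have c: "(\<Sum>k<d'. u' k i * cnj (u' k j)) = (if i = j then 1 else 0)" if "i \<in> I" "j \<in> I" for i j
    using 1(4)[rule_format, OF that(2,1), symmetric] that(2)
    by (simp add: proj_on_def ipa mult.commute[of "cnj _"]) (simp add: a_def)
  \<comment> \<open>The trace of the resolution of the identity, computed over \<open>k\<close> and
    over \<open>i\<close>, shows that the family has exactly \<open>card I\<close> members.\<close>
  have "complex_of_nat d' = (\<Sum>k<d'. ip I (u' k) (u' k))" using 1(3) by (simp add: orthonormal_onD)
  also have "\<dots> = (\<Sum>i\<in>I. \<Sum>k<d'. u' k i * cnj (u' k i))"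
    unfolding ip_def by (subst sum.swap) (simp add: mult.commute)
  also have "\<dots> = of_nat (card I)" by (simp add: c)
  finally have "d' = card I" using of_nat_eq_iff by blast
  then show ?thesis using 1 c by (intro exI[of _ u']) auto
qed

section \<open>Schmidt decomposition\<close>

lemma exists_eigenvector:
  fixes G :: "nat \<Rightarrow> nat \<Rightarrow> complex"
  assumes "n > 0"
  shows "\<exists>mu b. (\<exists>i<n. b i \<noteq> 0) \<and> (\<forall>i<n. (\<Sum>j<n. G i j * b j) = mu * b i)"
proof -
  define A where "A = mat n n (\<lambda>(i, j). G i j)"
  have A: "A \<in> carrier_mat n n" by (simp add: A_def)
  from spectrum_non_empty[OF A assms] obtain mu where "eigenvalue A mu"
    unfolding spectrum_def by auto
  then obtain v where v: "v \<in> carrier_vec n" "v \<noteq> 0\<^sub>v n" "A *\<^sub>v v = mu \<cdot>\<^sub>v v"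
    unfolding eigenvalue_def eigenvector_def using A by auto
  have "(\<Sum>j<n. G i j * v $ j) = mu * v $ i" if "i < n" for i
  proof -
    have "(A *\<^sub>v v) $ i = (\<Sum>j<n. G i j * v $ j)"
      using that v(1) by (simp add: A_def scalar_prod_def atLeast0LessThan)
    then show ?thesis using v that by simp
  qed
  moreover have "\<exists>i<n. v $ i \<noteq> 0"
  proof (rule ccontr)
    assume "\<not> (\<exists>i<n. v $ i \<noteq> 0)"
    then have "v = 0\<^sub>v n" using v(1) by (intro eq_vecI) auto
    then show False using v(2) by simp
  qed
  ultimately show ?thesis by (intro exI[of _ mu] exI[of _ "\<lambda>i. v $ i"]) auto
qed

lemma ip_hermitian:
  assumes "\<And>i j. i \<in> I \<Longrightarrow> j \<in> I \<Longrightarrow> H j i = cnj (H i j)"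
  shows "ip I u (\<lambda>i. \<Sum>j\<in>I. H i j * v j) = ip I (\<lambda>i. \<Sum>j\<in>I. H i j * u j) v"
proof -
  have "ip I u (\<lambda>i. \<Sum>j\<in>I. H i j * v j) = (\<Sum>i\<in>I. \<Sum>j\<in>I. cnj (u i) * (H i j * v j))"
    by (simp add: ip_def sum_distrib_left)
  also have "\<dots> = (\<Sum>j\<in>I. \<Sum>i\<in>I. cnj (u i) * (H i j * v j))" by (rule sum.swap)
  also have "\<dots> = (\<Sum>j\<in>I. \<Sum>i\<in>I. cnj (H j i * u i) * v j)"
  proof (intro sum.cong refl)
    fix i j assume "j \<in> I" "i \<in> I"
    then have "H i j = cnj (H j i)" by (rule assms)
    then show "cnj (u i) * (H i j * v j) = cnj (H j i * u i) * v j" by simp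
  qed
  also have "\<dots> = ip I (\<lambda>i. \<Sum>j\<in>I. H i j * u j) v"
    by (simp add: ip_def sum_distrib_right cnj_sum)
  finally show ?thesis .
qed

text \<open>Spectral theorem by induction on \<open>k\<close>: as \<open>H\<close> is self-adjoint,
  the orthogonal complement of the eigenvectors found so far is invariant, and the compression of
  \<open>H\<close> to it has an eigenvector.\<close>

lemma hermitian_eigenvectors:
  fixes H :: "nat \<Rightarrow> nat \<Rightarrow> complex"
  assumes H: "\<And>i j. i < n \<Longrightarrow> j < n \<Longrightarrow> H j i = cnj (H i j)" and "k \<le> n"
  shows "\<exists>u lam. orthonormal_on {..<n} k u \<and>
           (\<forall>l<k. \<forall>i<n. (\<Sum>j<n. H i j * u l j) = lam l * u l i)"
  using \<open>k \<le> n\<close>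
proof (induction k)
  case 0
  then show ?case by (simp add: orthonormal_on_def)
next
  case (Suc k)
  then obtain u lam where u: "orthonormal_on {..<n} k u"
    and ev: "\<forall>l<k. \<forall>i<n. (\<Sum>j<n. H i j * u l j) = lam l * u l i" by auto
  from orthonormal_on_complete[OF _ u]
  obtain u' where u': "\<forall>l<k. u' l = u l" "orthonormal_on {..<n} n u'"
    and comp: "\<forall>i<n. \<forall>j<n. (\<Sum>l<n. u' l i * cnj (u' l j)) = (if i = j then 1 else 0)"
    by auto
  define Hm where "Hm = (\<lambda>v i. \<Sum>j<n. H i j * v j)"
  have adj: "ip {..<n} x (Hm y) = ip {..<n} (Hm x) y" for x y
    unfolding Hm_def by (rule ip_hermitian, rule H) auto
  have expand: "y i = (\<Sum>l<n. ip {..<n} (u' l) y * u' l i)" if "i < n" for y i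
  proof -
    have "(\<Sum>l<n. ip {..<n} (u' l) y * u' l i) = (\<Sum>j<n. y j * (\<Sum>l<n. u' l i * cnj (u' l j)))"
      unfolding ip_def sum_distrib_left sum_distrib_right
      by (subst sum.swap) (simp add: mult_ac)
    also have "\<dots> = (\<Sum>j<n. if i = j then y j else 0)"
      by (intro sum.cong refl) (use comp that in auto)
    finally show ?thesis using that by simp
  qed
  define m where "m = n - k"
  have m: "m > 0" "n = k + m" using Suc.prems by (auto simp: m_def)
  \<comment> \<open>This matrix is the compression of \<open>H\<close> to the complement, in the
    basis of the \<open>u' (k + a)\<close> with \<open>a < m\<close>.\<close>
  from exists_eigenvector[OF m(1), of "\<lambda>a b. ip {..<n} (u' (k + a)) (Hm (u' (k + b)))"]
  obtain mu b where b0: "\<exists>i<m. b i \<noteq> 0"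
    and b: "\<forall>a<m. (\<Sum>c<m. ip {..<n} (u' (k + a)) (Hm (u' (k + c))) * b c) = mu * b a" by auto
  define v where "v = (\<lambda>i. \<Sum>c<m. b c * u' (k + c) i)"
  have o2: "orthonormal_on {..<n} m (\<lambda>c. u' (k + c))"
    using u'(2) m(2) unfolding orthonormal_on_def by auto
  have Hv: "Hm v = (\<lambda>i. \<Sum>c<m. b c * Hm (u' (k + c)) i)"
    unfolding Hm_def v_def sum_distrib_left by (rule ext, subst sum.swap) (simp add: mult_ac)
  have ipl: "ip {..<n} (u' l) v = 0" if "l < k" for l
    unfolding v_def ip_sum_right using that u'(2) m(2)
    by (intro sum.neutral) (auto simp: orthonormal_onD)
  \<comment> \<open>\<open>Hm v\<close> and \<open>mu * v\<close> are compared through their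
    coefficients in the full basis. For \<open>l < k\<close> both vanish, since \<open>u' l\<close>
    is an eigenvector orthogonal to \<open>v\<close>; the others are the eigenvector equation of the
    compression.\<close>
  have "ip {..<n} (u' l) (Hm v) = mu * ip {..<n} (u' l) v" if l: "l < n" for l
  proof (cases "l < k")
    case True
    have "ip {..<n} (Hm (u' l)) v = ip {..<n} (\<lambda>i. lam l * u' l i) v"
      using ev u'(1) True by (intro ip_cong) (auto simp: Hm_def)
    also have "\<dots> = 0" using ipl[OF True] by (simp add: ip_scale_left)
    finally show ?thesis using ipl[OF True] by (simp add: adj)
  next
    case False
    then obtain a where a: "l = k + a" "a < m" using l m(2) by (metis add_less_cancel_left le_Suc_ex not_less)
    have "ip {..<n} (u' l) (Hm v) = (\<Sum>c<m. b c * ip {..<n} (u' (k + a)) (Hm (u' (k + c))))"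
      unfolding Hv ip_sum_right a ..
    also have "\<dots> = mu * b a" using b a by (simp add: mult.commute)
    also have "b a = ip {..<n} (u' l) v"
      unfolding v_def using ip_orthonormal_sum[OF o2 a(2)] a(1) by simp
    finally show ?thesis .
  qed
  then have ev': "Hm v i = mu * v i" if "i < n" for i
    using expand[OF that, of "Hm v"] expand[OF that, of v]
    by (simp add: sum_distrib_left mult_ac)
  define N where "N = nrm2 {..<n} v"
  have "N = (\<Sum>c<m. (cmod (b c))\<^sup>2)" unfolding N_def v_def by (rule nrm2_orthonormal_sum[OF o2])
  also have "\<dots> > 0"
    using b0 by (auto intro!: sum_pos2)
  finally have N: "N > 0" .
  define c where "c = complex_of_real (1 / sqrt N)"
  have c: "cnj c = c" "c * (c * complex_of_real N) = 1"
    using N by (simp_all add: c_def flip: of_real_mult)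
  define w where "w = u(k := \<lambda>i. c * v i)"
  have ipl': "ip {..<n} v (u' l) = 0" if "l < k" for l
    using ipl[OF that] cnj_ip[of "{..<n}" "u' l" v] by simp
  have "orthonormal_on {..<n} (Suc k) w"
    unfolding orthonormal_on_def
  proof (intro allI impI)
    fix a d assume "a < Suc k" "d < Suc k"
    then show "ip {..<n} (w a) (w d) = (if a = d then 1 else 0)"
      using u ipl[of a] ipl'[of d] u'(1) c
      by (cases "a = k"; cases "d = k")
        (auto simp: w_def orthonormal_onD ip_scale_left ip_scale_right ip_self simp flip: N_def)
  qed
  moreover have "(\<Sum>j<n. H i j * w l j) = (lam(k := mu)) l * w l i" if "l < Suc k" "i < n" for l i
  proof (cases "l = k")
    case True
    have "(\<Sum>j<n. H i j * w l j) = c * Hm v i"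
      by (simp add: w_def True Hm_def sum_distrib_left mult_ac)
    then show ?thesis using ev'[OF that(2)] by (simp add: w_def True mult_ac)
  next
    case False
    then show ?thesis using ev that by (auto simp: w_def)
  qed
  ultimately show ?case by blast
qed

text \<open>The product \<open>H\<close> of \<open>X\<close> with its adjoint is diagonalized. The
  components \<open>w k\<close> of \<open>X\<close> along the eigenvectors \<open>u k\<close> are
  then mutually orthogonal, with the eigenvalues as squared norms, and the nonzero ones among them
  are normalized.\<close>

lemma schmidt_decomposition_on:
  fixes X :: "nat \<Rightarrow> 'b \<Rightarrow> complex"
  assumes J: "finite J"
  shows "\<exists>r s e f. orthonormal_on {..<n} r e \<and> orthonormal_on J r f \<and> (\<forall>k<r. s k > 0) \<and>
           (\<forall>i<n. \<forall>j\<in>J. X i j = (\<Sum>k<r. complex_of_real (s k) * (e k i * f k j)))"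
proof -
  define H where "H = (\<lambda>i l. \<Sum>j\<in>J. X i j * cnj (X l j))"
  have "H j i = cnj (H i j)" for i j by (simp add: H_def mult.commute)
  from hermitian_eigenvectors[of n H n, OF this]
  obtain u lam where u: "orthonormal_on {..<n} n u"
    and ev: "\<forall>l<n. \<forall>i<n. (\<Sum>j<n. H i j * u l j) = lam l * u l i" by auto
  from orthonormal_on_complete[OF _ u] obtain u' where "\<forall>k<n. u' k = u k"
    "\<forall>i<n. \<forall>j<n. (\<Sum>k<n. u' k i * cnj (u' k j)) = (if i = j then 1 else 0)"
    by auto
  then have comp: "\<forall>i<n. \<forall>j<n. (\<Sum>k<n. u k i * cnj (u k j)) = (if i = j then 1 else 0)"
    by auto
  define w where "w = (\<lambda>k j. \<Sum>i<n. cnj (u k i) * X i j)"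
  have orth: "ip J (w k) (w l) = (if k = l then lam k else 0)" if "k < n" "l < n" for k l
  proof -
    have "ip J (w k) (w l) = (\<Sum>j\<in>J. (\<Sum>i<n. u k i * cnj (X i j)) * (\<Sum>i'<n. cnj (u l i') * X i' j))"
      by (simp add: ip_def w_def)
    also have "\<dots> = (\<Sum>j\<in>J. \<Sum>i<n. \<Sum>i'<n. (u k i * cnj (X i j)) * (cnj (u l i') * X i' j))"
      unfolding sum_product ..
    also have "\<dots> = (\<Sum>j\<in>J. \<Sum>i'<n. \<Sum>i<n. (u k i * cnj (X i j)) * (cnj (u l i') * X i' j))"
      by (intro sum.cong refl sum.swap)
    also have "\<dots> = (\<Sum>i'<n. \<Sum>j\<in>J. \<Sum>i<n. (u k i * cnj (X i j)) * (cnj (u l i') * X i' j))"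
      by (rule sum.swap)
    also have "\<dots> = (\<Sum>i'<n. \<Sum>i<n. \<Sum>j\<in>J. (u k i * cnj (X i j)) * (cnj (u l i') * X i' j))"
      by (intro sum.cong refl sum.swap)
    also have "\<dots> = (\<Sum>i'<n. cnj (u l i') * (\<Sum>i<n. H i' i * u k i))"
      by (simp add: H_def sum_distrib_left sum_distrib_right mult_ac)
    also have "\<dots> = (\<Sum>i'<n. cnj (u l i') * (lam k * u k i'))" using ev that by simp
    also have "\<dots> = lam k * ip {..<n} (u l) (u k)" by (simp add: ip_def sum_distrib_left mult_ac)
    finally show ?thesis using u that by (simp add: orthonormal_onD)
  qed
  have X: "X i j = (\<Sum>k<n. u k i * w k j)" if "i < n" for i j
  proof -
    have "(\<Sum>k<n. u k i * w k j) = (\<Sum>l<n. X l j * (\<Sum>k<n. u k i * cnj (u k l)))"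
      unfolding w_def sum_distrib_left by (subst sum.swap) (simp add: mult_ac)
    also have "\<dots> = (\<Sum>l<n. if i = l then X l j else 0)"
      by (intro sum.cong refl) (use comp that in auto)
    finally show ?thesis using that by simp
  qed
  \<comment> \<open>Terms with vanishing \<open>w k\<close> are dropped, so that all coefficients
    are positive; \<open>h\<close> renumbers the others as an initial segment, the index set of
    \<open>orthonormal_on\<close>.\<close>
  define S where "S = {k. k < n \<and> nrm2 J (w k) \<noteq> 0}"
  have "finite S" by (simp add: S_def)
  then obtain h where h: "bij_betw h {0..<card S} S" using ex_bij_betw_nat_finite by blast
  have hS: "h k < n" "nrm2 J (w (h k)) > 0" if "k < card S" for k
    using bij_betwE[OF h] that nrm2_nonneg[of J "w (h k)"] by (auto simp: S_def less_le)
  have hinj: "h k = h l \<longleftrightarrow> k = l" if "k < card S" "l < card S" for k l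
    using h that by (auto simp: bij_betw_def inj_on_eq_iff)
  define s where "s = (\<lambda>k. sqrt (nrm2 J (w (h k))))"
  define f where "f = (\<lambda>k j. complex_of_real (1 / s k) * w (h k) j)"
  have s: "s k > 0" if "k < card S" for k using hS[OF that] by (simp add: s_def)
  have "orthonormal_on J (card S) f"
    unfolding orthonormal_on_def
  proof (intro allI impI)
    fix k l assume kl: "k < card S" "l < card S"
    show "ip J (f k) (f l) = (if k = l then 1 else 0)"
    proof (cases "k = l")
      case True
      have "1 / s k * (1 / s k * (s k)\<^sup>2) = 1" using s[OF kl(1)] by (simp add: power2_eq_square)
      moreover have "nrm2 J (w (h k)) = (s k)\<^sup>2" using hS[OF kl(1)] by (simp add: s_def)
      ultimately show ?thesis unfolding f_def True ip_scale_left ip_scale_right ip_self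
        by (simp only: complex_cnj_complex_of_real True flip: of_real_mult) simp
    next
      case False
      then show ?thesis using orth[OF hS(1)[OF kl(1)] hS(1)[OF kl(2)]] hinj[OF kl]
        by (simp add: f_def ip_scale_left ip_scale_right del: of_real_divide)
    qed
  qed
  moreover have "orthonormal_on {..<n} (card S) (\<lambda>k. u (h k))"
    unfolding orthonormal_on_def using u hS hinj by (auto simp: orthonormal_onD)
  moreover have "X i j = (\<Sum>k<card S. complex_of_real (s k) * (u (h k) i * f k j))"
    if "i < n" "j \<in> J" for i j
  proof -
    have "w k j = 0" if "k < n" "k \<notin> S" for k
      using that J \<open>j \<in> J\<close> by (auto simp: S_def nrm2_eq_0_iff)
    then have "X i j = (\<Sum>k\<in>S. u k i * w k j)"
      unfolding X[OF that(1)] by (intro sum.mono_neutral_right) (auto simp: S_def)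
    also have "\<dots> = (\<Sum>k<card S. u (h k) i * w (h k) j)"
      using sum.reindex_bij_betw[OF h, of "\<lambda>k. u k i * w k j"] by (simp add: atLeast0LessThan)
    also have "\<dots> = (\<Sum>k<card S. complex_of_real (s k) * (u (h k) i * f k j))"
      using s by (intro sum.cong refl) (force simp: f_def)
    finally show ?thesis .
  qed
  ultimately show ?thesis using s by blast
qed

section \<open>Majorization of Schmidt coefficients\<close>

lemma nrm2_product_sum:
  assumes "orthonormal_on I d u"
  shows "(\<Sum>i\<in>I. \<Sum>j\<in>J. (cmod (\<Sum>a<d. u a i * b a j))\<^sup>2) = (\<Sum>a<d. nrm2 J (b a))"
proof -
  have "(\<Sum>i\<in>I. \<Sum>j\<in>J. (cmod (\<Sum>a<d. u a i * b a j))\<^sup>2) = (\<Sum>j\<in>J. nrm2 I (\<lambda>i. \<Sum>a<d. b a j * u a i))"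
    by (subst sum.swap) (simp add: nrm2_def mult.commute)
  also have "\<dots> = (\<Sum>j\<in>J. \<Sum>a<d. (cmod (b a j))\<^sup>2)"
    by (simp add: nrm2_orthonormal_sum[OF assms])
  also have "\<dots> = (\<Sum>a<d. \<Sum>j\<in>J. (cmod (b a j))\<^sup>2)" by (rule sum.swap)
  finally show ?thesis by (simp add: nrm2_def)
qed

text \<open>The left factors of \<open>phi\<close> span at most \<open>card K\<close> dimensions.
  Only the part of \<open>om\<close> over this span contributes to the overlap, and its squared norm
  is a sum of the \<open>(t l)\<^sup>2\<close> with weights in [0, 1] of total at most
  \<open>card K\<close>. Charging \<open>th\<close> per unit of weight leaves at most the excess of
  each \<open>(t l)\<^sup>2\<close> over \<open>th\<close>.\<close>

lemma overlap_bound: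
  assumes I: "finite I" and J: "finite J" and K: "finite K"
    and g: "orthonormal_on I d g" and h: "orthonormal_on J d h" and th: "th \<ge> 0"
    and phi: "\<And>i j. i \<in> I \<Longrightarrow> j \<in> J \<Longrightarrow> phi i j = (\<Sum>k\<in>K. al k i * be k j)"
    and om: "\<And>i j. i \<in> I \<Longrightarrow> j \<in> J \<Longrightarrow> om i j = (\<Sum>l<d. complex_of_real (t l) * (g l i * h l j))"
  shows "(cmod (\<Sum>i\<in>I. \<Sum>j\<in>J. cnj (phi i j) * om i j))\<^sup>2
         \<le> (real (card K) * th + (\<Sum>l<d. max 0 ((t l)\<^sup>2 - th))) * (\<Sum>i\<in>I. \<Sum>j\<in>J. (cmod (phi i j))\<^sup>2)"
proof -
  have "orthonormal_on I 0 (\<lambda>_ _. 0)" by (simp add: orthonormal_on_def)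
  from gram_schmidt_on[OF I K this, of al] obtain d' u where u: "d' \<le> card K" "orthonormal_on I d' u"
    "\<forall>k\<in>K. \<forall>i\<in>I. al k i = proj_on I d' u (al k) i" by auto
  define b where "b = (\<lambda>a j. \<Sum>k\<in>K. ip I (u a) (al k) * be k j)"
  have phi': "phi i j = (\<Sum>a<d'. u a i * b a j)" if "i \<in> I" "j \<in> J" for i j
  proof -
    have al: "al k i = (\<Sum>a<d'. ip I (u a) (al k) * u a i)" if "k \<in> K" for k
      using u(3) that \<open>i \<in> I\<close> unfolding proj_on_def by blast
    have "phi i j = (\<Sum>k\<in>K. (\<Sum>a<d'. ip I (u a) (al k) * u a i) * be k j)"
      unfolding phi[OF that] by (intro sum.cong refl arg_cong2[where f = "(*)"] al)
    also have "\<dots> = (\<Sum>k\<in>K. \<Sum>a<d'. u a i * (ip I (u a) (al k) * be k j))"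
      unfolding sum_distrib_right by (simp add: mult_ac)
    also have "\<dots> = (\<Sum>a<d'. u a i * b a j)"
      unfolding b_def sum_distrib_left by (rule sum.swap)
    finally show ?thesis .
  qed
  \<comment> \<open>\<open>z a\<close> is the partial inner product of \<open>om\<close> with
    \<open>u a\<close>. The overlap becomes the inner product of \<open>b\<close> and
    \<open>z\<close>, ready for Cauchy-Schwarz.\<close>
  define z where "z = (\<lambda>a j. \<Sum>l<d. (complex_of_real (t l) * ip I (u a) (g l)) * h l j)"
  have "(\<Sum>i\<in>I. \<Sum>j\<in>J. cnj (phi i j) * om i j)
      = (\<Sum>i\<in>I. \<Sum>j\<in>J. \<Sum>a<d'. cnj (u a i) * cnj (b a j) * om i j)"
    by (intro sum.cong refl) (simp add: phi' sum_distrib_right)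
  also have "\<dots> = (\<Sum>i\<in>I. \<Sum>a<d'. \<Sum>j\<in>J. cnj (u a i) * cnj (b a j) * om i j)"
    by (intro sum.cong refl sum.swap)
  also have "\<dots> = (\<Sum>a<d'. \<Sum>i\<in>I. \<Sum>j\<in>J. cnj (u a i) * cnj (b a j) * om i j)"
    by (rule sum.swap)
  also have "\<dots> = (\<Sum>a<d'. \<Sum>j\<in>J. \<Sum>i\<in>I. cnj (u a i) * cnj (b a j) * om i j)"
    by (intro sum.cong refl sum.swap)
  also have "\<dots> = (\<Sum>a<d'. \<Sum>j\<in>J. cnj (b a j) * z a j)"
  proof (intro sum.cong refl)
    fix a j assume j: "j \<in> J"
    have "(\<Sum>i\<in>I. cnj (u a i) * cnj (b a j) * om i j)
        = (\<Sum>i\<in>I. \<Sum>l<d. cnj (b a j) * (complex_of_real (t l) * (cnj (u a i) * g l i) * h l j))"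
      using j by (intro sum.cong refl) (simp add: om sum_distrib_left mult_ac)
    also have "\<dots> = (\<Sum>l<d. \<Sum>i\<in>I. cnj (b a j) * (complex_of_real (t l) * (cnj (u a i) * g l i) * h l j))"
      by (rule sum.swap)
    also have "\<dots> = cnj (b a j) * z a j"
      by (simp add: z_def ip_def sum_distrib_left sum_distrib_right mult_ac)
    finally show "(\<Sum>i\<in>I. cnj (u a i) * cnj (b a j) * om i j) = cnj (b a j) * z a j" .
  qed
  also have "\<dots> = ip ({..<d'} \<times> J) (\<lambda>(a, j). b a j) (\<lambda>(a, j). z a j)"
    unfolding ip_def by (simp add: sum.cartesian_product case_prod_unfold)
  finally have ov: "(\<Sum>i\<in>I. \<Sum>j\<in>J. cnj (phi i j) * om i j) = \<dots>" .
  have nb: "nrm2 ({..<d'} \<times> J) (\<lambda>(a, j). b a j) = (\<Sum>i\<in>I. \<Sum>j\<in>J. (cmod (phi i j))\<^sup>2)"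
  proof -
    have "nrm2 ({..<d'} \<times> J) (\<lambda>(a, j). b a j) = (\<Sum>a<d'. nrm2 J (b a))"
      unfolding nrm2_def by (simp add: sum.cartesian_product case_prod_unfold)
    also have "\<dots> = (\<Sum>i\<in>I. \<Sum>j\<in>J. (cmod (\<Sum>a<d'. u a i * b a j))\<^sup>2)"
      by (rule nrm2_product_sum[OF u(2), symmetric])
    finally show ?thesis using phi' by simp
  qed
  \<comment> \<open>\<open>p l\<close> is the squared norm of the projection of \<open>g l\<close>
    onto the span of \<open>u\<close>.\<close>
  define p where "p = (\<lambda>l. \<Sum>a<d'. (cmod (ip I (u a) (g l)))\<^sup>2)"
  have "nrm2 ({..<d'} \<times> J) (\<lambda>(a, j). z a j) = (\<Sum>a<d'. nrm2 J (z a))"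
    unfolding nrm2_def by (simp add: sum.cartesian_product case_prod_unfold)
  also have "\<dots> = (\<Sum>a<d'. \<Sum>l<d. (t l)\<^sup>2 * (cmod (ip I (u a) (g l)))\<^sup>2)"
    unfolding z_def nrm2_orthonormal_sum[OF h] by (simp add: norm_mult power_mult_distrib)
  also have "\<dots> = (\<Sum>l<d. (t l)\<^sup>2 * p l)"
    unfolding p_def sum_distrib_left by (rule sum.swap)
  also have "\<dots> \<le> (\<Sum>l<d. th * p l + max 0 ((t l)\<^sup>2 - th))"
  proof (intro sum_mono)
    fix l assume l: "l \<in> {..<d}"
    have p1: "p l \<le> 1" unfolding p_def using bessel[OF u(2), of "g l"] orthonormal_on_nrm2[OF g] l by auto
    have p0: "p l \<ge> 0" unfolding p_def by (intro sum_nonneg) auto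
    have "((t l)\<^sup>2 - th) * p l \<le> max 0 ((t l)\<^sup>2 - th) * p l" by (rule mult_right_mono) (use p0 in auto)
    also have "\<dots> \<le> max 0 ((t l)\<^sup>2 - th) * 1" by (rule mult_left_mono) (use p1 in auto)
    finally show "(t l)\<^sup>2 * p l \<le> th * p l + max 0 ((t l)\<^sup>2 - th)" by (simp add: algebra_simps)
  qed
  also have "\<dots> = th * (\<Sum>l<d. p l) + (\<Sum>l<d. max 0 ((t l)\<^sup>2 - th))"
    by (simp add: sum.distrib sum_distrib_left)
  finally have zp: "nrm2 ({..<d'} \<times> J) (\<lambda>(a, j). z a j)
      \<le> th * (\<Sum>l<d. p l) + (\<Sum>l<d. max 0 ((t l)\<^sup>2 - th))" .
  \<comment> \<open>Bessel with the roles exchanged: \<open>g\<close> is now the orthonormal family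
    and \<open>u a\<close> the unit vector that it measures.\<close>
  have pK: "(\<Sum>l<d. p l) \<le> real (card K)"
  proof -
    have "(\<Sum>l<d. p l) = (\<Sum>a<d'. \<Sum>l<d. (cmod (ip I (u a) (g l)))\<^sup>2)"
      unfolding p_def by (rule sum.swap)
    also have "\<dots> \<le> (\<Sum>a<d'. 1)"
    proof (rule sum_mono)
      fix a assume a: "a \<in> {..<d'}"
      have "cmod (ip I (u a) (g l)) = cmod (ip I (g l) (u a))" for l
        unfolding cnj_ip[of I "g l" "u a", symmetric] by simp
      then show "(\<Sum>l<d. (cmod (ip I (u a) (g l)))\<^sup>2) \<le> 1"
        using bessel[OF g, of "u a"] orthonormal_on_nrm2[OF u(2)] a by simp
    qed
    finally show ?thesis using u(1) by simp
  qed
  have nz: "nrm2 ({..<d'} \<times> J) (\<lambda>(a, j). z a j)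
      \<le> real (card K) * th + (\<Sum>l<d. max 0 ((t l)\<^sup>2 - th))"
    using zp mult_left_mono[OF pK th] by (simp add: mult.commute)
  have "(cmod (\<Sum>i\<in>I. \<Sum>j\<in>J. cnj (phi i j) * om i j))\<^sup>2 \<le>
      nrm2 ({..<d'} \<times> J) (\<lambda>(a, j). b a j) * nrm2 ({..<d'} \<times> J) (\<lambda>(a, j). z a j)"
    unfolding ov by (rule ip_cauchy_schwarz) (use J in simp)
  also have "\<dots> \<le> nrm2 ({..<d'} \<times> J) (\<lambda>(a, j). b a j) * (real (card K) * th + (\<Sum>l<d. max 0 ((t l)\<^sup>2 - th)))"
    by (rule mult_left_mono[OF nz nrm2_nonneg])
  finally show ?thesis unfolding nb by (simp add: mult.commute)
qed

lemma overlap_bound_pair: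
  assumes "finite I" "finite J" "finite K" "orthonormal_on I d g" "orthonormal_on J d h" "th \<ge> 0"
    and "\<And>i j. i \<in> I \<Longrightarrow> j \<in> J \<Longrightarrow> phi (i, j) = (\<Sum>k\<in>K. al k i * be k j)"
    and "\<And>i j. i \<in> I \<Longrightarrow> j \<in> J \<Longrightarrow> om (i, j) = (\<Sum>l<d. complex_of_real (t l) * (g l i * h l j))"
  shows "(cmod (ip (I \<times> J) phi om))\<^sup>2
         \<le> (real (card K) * th + (\<Sum>l<d. max 0 ((t l)\<^sup>2 - th))) * nrm2 (I \<times> J) phi"
  using overlap_bound[OF assms(1-6), of "\<lambda>i j. phi (i, j)" al be "\<lambda>i j. om (i, j)" t, OF assms(7,8)]
  by (simp add: ip_def nrm2_def sum.cartesian_product case_prod_unfold)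

lemma ip_product: "ip (I \<times> J) (\<lambda>(i, j). a i * b j) (\<lambda>(i, j). c i * d j) = ip I a c * ip J b d"
  by (simp add: ip_def sum_product sum.cartesian_product case_prod_unfold mult_ac)

lemma nrm2_schmidt:
  assumes g: "orthonormal_on I d g" and h: "orthonormal_on J d h"
    and om: "\<And>i j. i \<in> I \<Longrightarrow> j \<in> J \<Longrightarrow> om (i, j) = (\<Sum>l<d. complex_of_real (t l) * (g l i * h l j))"
  shows "nrm2 (I \<times> J) om = (\<Sum>l<d. (t l)\<^sup>2)"
proof -
  have "orthonormal_on (I \<times> J) d (\<lambda>l. \<lambda>(i, j). g l i * h l j)"
    using g h unfolding orthonormal_on_def ip_product by auto
  from nrm2_orthonormal_sum[OF this, of "\<lambda>l. complex_of_real (t l)"]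
  have "nrm2 (I \<times> J) (\<lambda>z. \<Sum>l<d. complex_of_real (t l) * (case z of (i, j) \<Rightarrow> g l i * h l j)) = (\<Sum>l<d. (t l)\<^sup>2)"
    by simp
  moreover have "nrm2 (I \<times> J) om = nrm2 (I \<times> J) (\<lambda>z. \<Sum>l<d. complex_of_real (t l) * (case z of (i, j) \<Rightarrow> g l i * h l j))"
    by (intro nrm2_cong) (auto simp: om)
  ultimately show ?thesis by simp
qed

section \<open>Schmidt terms of the resource under the branches\<close>

text \<open>By \<open>comp\<close>, the images of the Schmidt terms, taken over all branches
  together, are orthonormal, so two partial sums overlap exactly in their common terms.\<close>

lemma gram_sum:
  fixes r M :: nat
  assumes comp: "\<And>k l. k < r \<Longrightarrow> l < r \<Longrightarrow>
      (\<Sum>m<M. ip I (a m k) (a m l) * ip J (b m k) (b m l)) = (if k = l then 1 else (0::complex))"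
    and A: "A \<subseteq> {..<r}" and B: "B \<subseteq> {..<r}"
  shows "(\<Sum>m<M. ip (I \<times> J) (\<lambda>z. \<Sum>k\<in>A. complex_of_real (s k) * (case z of (i, j) \<Rightarrow> a m k i * b m k j))
                             (\<lambda>z. \<Sum>k\<in>B. complex_of_real (s k) * (case z of (i, j) \<Rightarrow> a m k i * b m k j)))
         = complex_of_real (\<Sum>k\<in>A \<inter> B. (s k)\<^sup>2)"
proof -
  have fin: "finite A" "finite B" using finite_subset[OF A] finite_subset[OF B] by simp_all
  have "(\<Sum>m<M. ip (I \<times> J) (\<lambda>z. \<Sum>k\<in>A. complex_of_real (s k) * (case z of (i, j) \<Rightarrow> a m k i * b m k j))
                             (\<lambda>z. \<Sum>k\<in>B. complex_of_real (s k) * (case z of (i, j) \<Rightarrow> a m k i * b m k j)))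
      = (\<Sum>m<M. \<Sum>k\<in>A. \<Sum>l\<in>B. complex_of_real (s k) * complex_of_real (s l) *
            (ip I (a m k) (a m l) * ip J (b m k) (b m l)))"
    unfolding ip_sum_left ip_sum_right ip_product by (simp add: sum_distrib_left mult_ac)
  also have "\<dots> = (\<Sum>k\<in>A. \<Sum>m<M. \<Sum>l\<in>B. complex_of_real (s k) * complex_of_real (s l) *
            (ip I (a m k) (a m l) * ip J (b m k) (b m l)))"
    by (rule sum.swap)
  also have "\<dots> = (\<Sum>k\<in>A. \<Sum>l\<in>B. \<Sum>m<M. complex_of_real (s k) * complex_of_real (s l) *
            (ip I (a m k) (a m l) * ip J (b m k) (b m l)))"
    by (intro sum.cong refl sum.swap)
  also have "\<dots> = (\<Sum>k\<in>A. \<Sum>l\<in>B. if k = l then complex_of_real ((s k)\<^sup>2) else 0)"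
    unfolding sum_distrib_left[symmetric] using A B
    by (intro sum.cong refl) (auto simp: comp subset_iff power2_eq_square)
  also have "\<dots> = (\<Sum>k\<in>A. if k \<in> B then complex_of_real ((s k)\<^sup>2) else 0)"
    using fin by (intro sum.cong refl) simp
  also have "\<dots> = (\<Sum>k\<in>A \<inter> B. complex_of_real ((s k)\<^sup>2))"
    by (rule sum.inter_restrict[OF fin(1), symmetric])
  finally show ?thesis by simp
qed

text \<open>Conservation of norm: the branch images of the whole resource are the multiples
  \<open>c m\<close> of \<open>om\<close>, and \<open>gram_sum\<close> with all terms on both sides
  adds up their squared norms.\<close>

lemma sum_branch_weights:
  fixes om :: "'a \<times> 'b \<Rightarrow> complex" and r M :: nat
  assumes gen: "\<And>m i j. m < M \<Longrightarrow> i \<in> I \<Longrightarrow> j \<in> J \<Longrightarrow>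
       c m * om (i, j) = (\<Sum>k<r. complex_of_real (s k) * (a m k i * b m k j))"
    and comp: "\<And>k l. k < r \<Longrightarrow> l < r \<Longrightarrow>
      (\<Sum>m<M. ip I (a m k) (a m l) * ip J (b m k) (b m l)) = (if k = l then 1 else 0)"
  shows "(\<Sum>m<M. (cmod (c m))\<^sup>2) * nrm2 (I \<times> J) om = (\<Sum>k<r. (s k)\<^sup>2)"
proof -
  define P where "P = (\<lambda>m z. \<Sum>k<r. complex_of_real (s k) * (case z of (i, j) \<Rightarrow> a m k i * b m k j))"
  have "(cmod (c m))\<^sup>2 * nrm2 (I \<times> J) om = nrm2 (I \<times> J) (P m)" if "m < M" for m
  proof -
    have "nrm2 (I \<times> J) (P m) = nrm2 (I \<times> J) (\<lambda>z. c m * om z)"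
      using gen[OF that] by (intro nrm2_cong) (auto simp: P_def)
    then show ?thesis by (simp add: nrm2_def norm_mult power_mult_distrib sum_distrib_left)
  qed
  then have "(\<Sum>m<M. (cmod (c m))\<^sup>2) * nrm2 (I \<times> J) om = (\<Sum>m<M. nrm2 (I \<times> J) (P m))"
    by (simp add: sum_distrib_right)
  also have "\<dots> = (\<Sum>k<r. (s k)\<^sup>2)"
  proof -
    have "complex_of_real (\<Sum>m<M. nrm2 (I \<times> J) (P m)) = complex_of_real (\<Sum>k<r. (s k)\<^sup>2)"
      using gram_sum[where s = s, OF comp subset_refl subset_refl] by (simp add: ip_self P_def)
    then show ?thesis unfolding of_real_eq_iff .
  qed
  finally show ?thesis .
qed

lemma schmidt_majorization:
  fixes om :: "'a \<times> 'b \<Rightarrow> complex" and r M :: nat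
  assumes I: "finite I" and J: "finite J"
    and g: "orthonormal_on I d g" and h: "orthonormal_on J d h" and th: "th \<ge> 0"
    and om: "\<And>i j. i \<in> I \<Longrightarrow> j \<in> J \<Longrightarrow> om (i, j) = (\<Sum>l<d. complex_of_real (t l) * (g l i * h l j))"
    and gen: "\<And>m i j. m < M \<Longrightarrow> i \<in> I \<Longrightarrow> j \<in> J \<Longrightarrow>
       c m * om (i, j) = (\<Sum>k<r. complex_of_real (s k) * (a m k i * b m k j))"
    and comp: "\<And>k l. k < r \<Longrightarrow> l < r \<Longrightarrow>
      (\<Sum>m<M. ip I (a m k) (a m l) * ip J (b m k) (b m l)) = (if k = l then 1 else 0)"
    and t1: "(\<Sum>l<d. (t l)\<^sup>2) = 1" and s1: "(\<Sum>k<r. (s k)\<^sup>2) = 1"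
  shows "(\<Sum>k<r. max 0 ((s k)\<^sup>2 - th)) \<le> (\<Sum>l<d. max 0 ((t l)\<^sup>2 - th))"
proof -
  \<comment> \<open>\<open>P A m\<close> is the image in branch \<open>m\<close> of the Schmidt
    terms with index in \<open>A\<close>; for \<open>A = {..<r}\<close> it agrees with
    \<open>c m\<close> times \<open>om\<close>.\<close>
  define P where "P = (\<lambda>A m z. \<Sum>k\<in>A. complex_of_real (s k) * (case z of (i, j) \<Rightarrow> a m k i * b m k j))"
  have gram: "(\<Sum>m<M. ip (I \<times> J) (P A m) (P B m)) = complex_of_real (\<Sum>k\<in>A \<inter> B. (s k)\<^sup>2)"
    if "A \<subseteq> {..<r}" "B \<subseteq> {..<r}" for A B
    unfolding P_def by (rule gram_sum[OF comp that])
  have PN: "ip (I \<times> J) v (P {..<r} m) = c m * ip (I \<times> J) v om" if "m < M" for m v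
    unfolding ip_scale_right[symmetric] using gen[OF that] by (intro ip_cong) (auto simp: P_def)
  have "nrm2 (I \<times> J) om = 1" using nrm2_schmidt[where om = om and t = t, OF g h om] t1 by simp
  then have c1: "(\<Sum>m<M. (cmod (c m))\<^sup>2) = 1"
    using sum_branch_weights[where om = om and c = c and s = s, OF gen comp] s1 by simp
  define K where "K = {k. k < r \<and> (s k)\<^sup>2 > th}"
  have K1: "K \<subseteq> {..<r}" by (auto simp: K_def)
  have K: "K \<subseteq> {..<r}" "finite K" using K1 finite_subset[OF K1] by simp_all
  \<comment> \<open>\<open>S\<close> is the squared norm of the truncated resource and
    \<open>T\<close> the factor that \<open>overlap_bound\<close> gives for \<open>card K\<close>
    product terms. The claim amounts to \<open>S \<le> T\<close>, because the left-hand sum equals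
    \<open>S - card K * th\<close>.\<close>
  define S where "S = (\<Sum>k\<in>K. (s k)\<^sup>2)"
  define T where "T = real (card K) * th + (\<Sum>l<d. max 0 ((t l)\<^sup>2 - th))"
  have T0: "T \<ge> 0" unfolding T_def using th by (intro add_nonneg_nonneg sum_nonneg) auto
  have S0: "S \<ge> 0" unfolding S_def by (intro sum_nonneg) auto
  have nK: "(\<Sum>m<M. nrm2 (I \<times> J) (P K m)) = S"
  proof -
    have "complex_of_real (\<Sum>m<M. nrm2 (I \<times> J) (P K m)) = complex_of_real S"
      using gram[OF K(1) K(1)] by (simp add: ip_self S_def)
    then show ?thesis using of_real_eq_iff by blast
  qed
  \<comment> \<open>Truncation is an orthogonal projection, so \<open>S\<close> is also the overlap
    of the truncated with the full resource. Read through the branches, it is an inner product over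
    \<open>m\<close> with the weights \<open>c m\<close>.\<close>
  have "complex_of_real S = (\<Sum>m<M. ip (I \<times> J) (P K m) (P {..<r} m))"
    using gram[OF K(1) subset_refl] K(1) by (simp add: S_def Int_absorb2)
  also have "\<dots> = ip {..<M} (\<lambda>m. cnj (c m)) (\<lambda>m. ip (I \<times> J) (P K m) om)"
    unfolding ip_def[of "{..<M}"] by (intro sum.cong) (auto simp: PN)
  finally have "S\<^sup>2 = (cmod (ip {..<M} (\<lambda>m. cnj (c m)) (\<lambda>m. ip (I \<times> J) (P K m) om)))\<^sup>2"
    by (metis norm_of_real power2_abs)
  also have "\<dots> \<le> nrm2 {..<M} (\<lambda>m. cnj (c m)) * nrm2 {..<M} (\<lambda>m. ip (I \<times> J) (P K m) om)"
    by (rule ip_cauchy_schwarz) simp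
  also have "\<dots> = (\<Sum>m<M. (cmod (ip (I \<times> J) (P K m) om))\<^sup>2)"
    using c1 by (simp add: nrm2_def)
  also have "\<dots> \<le> (\<Sum>m<M. T * nrm2 (I \<times> J) (P K m))"
  proof (rule sum_mono)
    fix m
    show "(cmod (ip (I \<times> J) (P K m) om))\<^sup>2 \<le> T * nrm2 (I \<times> J) (P K m)"
      unfolding T_def
      by (rule overlap_bound_pair[OF I J K(2) g h th, where
            al = "\<lambda>k i. complex_of_real (s k) * a m k i" and be = "b m"])
        (auto simp: P_def om mult_ac)
  qed
  also have "\<dots> = T * S" by (simp add: nK flip: sum_distrib_left)
  finally have "S * S \<le> T * S" by (simp add: power2_eq_square)
  then have ST: "S \<le> T" using S0 T0 by (cases "S = 0") auto
  have "(\<Sum>k<r. max 0 ((s k)\<^sup>2 - th)) = (\<Sum>k\<in>K. max 0 ((s k)\<^sup>2 - th))"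
    by (rule sum.mono_neutral_right) (auto simp: K_def)
  also have "\<dots> = (\<Sum>k\<in>K. (s k)\<^sup>2 - th)" by (intro sum.cong) (auto simp: K_def)
  also have "\<dots> = S - real (card K) * th" by (simp add: S_def sum_subtractf)
  finally show ?thesis using ST by (simp add: T_def)
qed

section \<open>From majorization to the inequality of entropies\<close>

text \<open>An antiderivative of \<open>\<theta> \<mapsto> min x \<theta> / \<theta>\<close>, with value \<open>x - x * ln x\<close> at \<open>\<theta> = 1 \<ge> x\<close>.\<close>

definition trunc_log :: "real \<Rightarrow> real \<Rightarrow> real" where
  "trunc_log x \<theta> = (if \<theta> \<le> x then \<theta> else x + x * ln (\<theta> / x))"

text \<open>Away from \<open>x\<close> a single formula holds near \<theta>; at the kink both
  one-sided difference quotients tend to 1, which is \<open>min x x / x\<close>.\<close>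

lemma trunc_log_deriv:
  assumes x: "x > 0" and th: "\<theta> > 0"
  shows "(trunc_log x has_real_derivative min x \<theta> / \<theta>) (at \<theta>)"
proof -
  \<comment> \<open>Stated within any \<open>S\<close>, since it serves both on a full neighbourhood
    and from the right at the kink.\<close>
  have g: "((\<lambda>\<theta>. x + x * ln (\<theta> / x)) has_real_derivative x / \<theta>) (at \<theta> within S)" for S
    using x th by (auto intro!: derivative_eq_intros)
  consider "\<theta> < x" | "\<theta> > x" | "\<theta> = x" by linarith
  then show ?thesis
  proof cases
    case 1
    have "\<forall>\<^sub>F t in nhds \<theta>. t < x" using 1 by (intro order_tendstoD[OF filterlim_ident]) auto
    then have "\<forall>\<^sub>F t in nhds \<theta>. trunc_log x t = t" by eventually_elim (simp add: trunc_log_def)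
    then have "(trunc_log x has_real_derivative 1) (at \<theta>) \<longleftrightarrow> ((\<lambda>t. t) has_real_derivative 1) (at \<theta>)"
      by (intro DERIV_cong_ev) auto
    then show ?thesis using 1 th by simp
  next
    case 2
    have "\<forall>\<^sub>F t in nhds \<theta>. t > x" using 2 by (intro order_tendstoD[OF filterlim_ident]) auto
    then have "\<forall>\<^sub>F t in nhds \<theta>. trunc_log x t = x + x * ln (t / x)"
      by eventually_elim (simp add: trunc_log_def)
    then have "(trunc_log x has_real_derivative x / \<theta>) (at \<theta>) \<longleftrightarrow>
        ((\<lambda>t. x + x * ln (t / x)) has_real_derivative x / \<theta>) (at \<theta>)"
      by (intro DERIV_cong_ev) auto
    then show ?thesis using 2 g[of UNIV] by simp
  next
    case 3
    have tx: "trunc_log x x = x" by (simp add: trunc_log_def)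
    have "((\<lambda>t. (trunc_log x t - trunc_log x x) / (t - x)) \<longlongrightarrow> 1) (at_left x)"
    proof (rule tendsto_eventually)
      show "\<forall>\<^sub>F t in at_left x. (trunc_log x t - trunc_log x x) / (t - x) = 1"
        using eventually_at_left_real[of 0 x] x by (auto elim!: eventually_mono simp: trunc_log_def tx)
    qed
    moreover have "((\<lambda>t. (trunc_log x t - trunc_log x x) / (t - x)) \<longlongrightarrow> 1) (at_right x)"
    proof (rule Lim_transform_eventually)
      show "((\<lambda>t. ((x + x * ln (t / x)) - (x + x * ln (x / x))) / (t - x)) \<longlongrightarrow> 1) (at_right x)"
        using g[of "{x<..}", unfolded 3 has_field_derivative_iff] x by simp
      show "\<forall>\<^sub>F t in at_right x. ((x + x * ln (t / x)) - (x + x * ln (x / x))) / (t - x) =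
          (trunc_log x t - trunc_log x x) / (t - x)"
        using eventually_at_right_real[of x "x + 1"] x
        by (auto elim!: eventually_mono simp: trunc_log_def)
    qed
    ultimately have "(trunc_log x has_real_derivative 1) (at x)"
      unfolding has_field_derivative_iff by (rule filterlim_split_at)
    then show ?thesis using 3 x by simp
  qed
qed

text \<open>Since both families sum to 1, the hinge inequality reverses into one for sums of
  \<open>min\<close>, the numerators in the derivative of \<open>trunc_log\<close>. Hence
  \<open>D\<close> is nondecreasing, and \<open>D 1\<close> is the entropy of \<open>x\<close> minus
  that of \<open>y\<close>.\<close>

lemma entropy_le_of_hinge:
  fixes x y :: "nat \<Rightarrow> real"
  assumes x: "\<And>k. k < r \<Longrightarrow> x k > 0" and y: "\<And>l. l < d \<Longrightarrow> y l > 0"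
    and x1: "(\<Sum>k<r. x k) = 1" and y1: "(\<Sum>l<d. y l) = 1"
    and hinge: "\<And>\<theta>. \<theta> \<ge> 0 \<Longrightarrow> (\<Sum>k<r. max 0 (x k - \<theta>)) \<le> (\<Sum>l<d. max 0 (y l - \<theta>))"
  shows "(\<Sum>k<r. x k * ln (x k)) \<le> (\<Sum>l<d. y l * ln (y l))"
proof -
  have min: "(\<Sum>l<d. min (y l) \<theta>) \<le> (\<Sum>k<r. min (x k) \<theta>)" if "\<theta> \<ge> 0" for \<theta>
  proof -
    have "max 0 (u - \<theta>) = u - min u \<theta>" for u :: real by simp
    then show ?thesis using hinge[OF that] x1 y1 by (simp add: sum_subtractf)
  qed
  have le1: "x k \<le> 1" if "k < r" for k
    using member_le_sum[of k "{..<r}" x] that x x1 by (simp add: less_imp_le)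
  have le1': "y l \<le> 1" if "l < d" for l
    using member_le_sum[of l "{..<d}" y] that y y1 by (simp add: less_imp_le)
  define D where "D = (\<lambda>\<theta>. (\<Sum>k<r. trunc_log (x k) \<theta>) - (\<Sum>l<d. trunc_log (y l) \<theta>))"
  \<comment> \<open>The comparison starts at the smallest entry \<open>e\<close>, which is positive,
    because the derivative is available for positive \<theta> only. At \<open>e\<close> each
    \<open>trunc_log\<close> still equals the corresponding \<open>min\<close>, so the sign of
    \<open>D e\<close> is known; including 1 ensures \<open>e \<le> 1\<close>.\<close>
  define W where "W = insert 1 (x ` {..<r} \<union> y ` {..<d})"
  define e where "e = Min W"
  have W: "finite W" "W \<noteq> {}" by (auto simp: W_def)
  have e: "e > 0" "e \<le> 1" "\<And>k. k < r \<Longrightarrow> e \<le> x k" "\<And>l. l < d \<Longrightarrow> e \<le> y l"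
    using W x y unfolding e_def by (auto simp: W_def)
  have De: "D e = (\<Sum>k<r. min (x k) e) - (\<Sum>l<d. min (y l) e)"
    using e by (simp add: D_def trunc_log_def min_absorb2)
  have "0 \<le> D e" unfolding De using min[of e] e by simp
  also have "D e \<le> D 1"
  proof (rule DERIV_nonneg_imp_nondecreasing[OF e(2)])
    fix \<theta> assume "e \<le> \<theta>"
    then have th: "\<theta> > 0" using e by simp
    have "(D has_real_derivative ((\<Sum>k<r. min (x k) \<theta> / \<theta>) - (\<Sum>l<d. min (y l) \<theta> / \<theta>))) (at \<theta>)"
      unfolding D_def by (intro DERIV_diff DERIV_sum trunc_log_deriv x y th) auto
    moreover have "(\<Sum>k<r. min (x k) \<theta> / \<theta>) - (\<Sum>l<d. min (y l) \<theta> / \<theta>) \<ge> 0"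
      using min[of \<theta>] th by (simp add: divide_right_mono flip: sum_divide_distrib)
    ultimately show "\<exists>z. (D has_real_derivative z) (at \<theta>) \<and> z \<ge> 0" by blast
  qed
  finally have "0 \<le> D 1" .
  \<comment> \<open>For \<open>u < 1\<close> this is the logarithmic branch of
    \<open>trunc_log\<close>; for \<open>u = 1\<close> the linear branch applies and the logarithm
    vanishes.\<close>
  have tl: "trunc_log u 1 = u - u * ln u" if "u > 0" "u \<le> 1" for u
    using that by (auto simp: trunc_log_def ln_div)
  have "D 1 = (\<Sum>k<r. x k - x k * ln (x k)) - (\<Sum>l<d. y l - y l * ln (y l))"
    unfolding D_def using tl x y le1 le1' by simp
  then show ?thesis using \<open>0 \<le> D 1\<close> x1 y1 by (simp add: sum_subtractf)
qed

section \<open>Coordinates of tensor products\<close>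

lemma pair_index_less: "(i::nat) < n \<Longrightarrow> j < m \<Longrightarrow> i * m + j < n * m"
proof -
  assume "i < n" "j < m"
  then have "i * m + j < Suc i * m" by simp
  also have "\<dots> \<le> n * m" using \<open>i < n\<close> by (intro mult_le_mono1) simp
  finally show ?thesis .
qed

lemma pair_index_div: "j < m \<Longrightarrow> (i * m + j) div m = (i::nat)"
  by simp

lemma sum_pair_index: "(\<Sum>k<n * m. f k) = (\<Sum>i<n. \<Sum>j<m. f (i * m + j :: nat))"
proof -
  have "sum f {i * m..<i * m + m} = (\<Sum>j<m. f (i * m + j))" for i
    using sum.shift_bounds_nat_ivl[of f 0 "i * m" m] by (simp add: atLeast0LessThan add.commute)
  then show ?thesis by (simp flip: sum.nat_group)
qed

lemma tensor_vec_carrier: "v \<in> carrier_vec n \<Longrightarrow> w \<in> carrier_vec m \<Longrightarrow> tensor_vec v w \<in> carrier_vec (n * m)"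
  by (auto simp: tensor_vec_def)

lemma tensor_vec_index:
  assumes "v \<in> carrier_vec n" "w \<in> carrier_vec m" "i < n" "j < m"
  shows "tensor_vec v w $ (i * m + j) = v $ i * w $ j"
  using assms pair_index_less[of i n j m] by (simp add: tensor_vec_def)

lemma tensor_mat_carrier:
  "A \<in> carrier_mat n n' \<Longrightarrow> B \<in> carrier_mat m m' \<Longrightarrow> tensor_mat A B \<in> carrier_mat (n * m) (n' * m')"
  by (auto simp: tensor_mat_def)

lemma tensor_mat_index:
  assumes "A \<in> carrier_mat n n'" "B \<in> carrier_mat m m'" "i < n" "j < m" "k < n'" "l < m'"
  shows "tensor_mat A B $$ (i * m + j, k * m' + l) = A $$ (i, k) * B $$ (j, l)"
  using assms pair_index_less[of i n j m] pair_index_less[of k n' l m'] by (simp add: tensor_mat_def)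

lemma swap_middle_index:
  assumes "i1 < n1" "i2 < n2" "i3 < n3" "i4 < n4"
  shows "swap_middle n1 n2 n3 n4 v $ ((i1 * n3 + i3) * (n2 * n4) + (i2 * n4 + i4))
         = v $ ((i1 * n2 + i2) * (n3 * n4) + (i3 * n4 + i4))"
proof -
  let ?k = "(i1 * n3 + i3) * (n2 * n4) + (i2 * n4 + i4)"
  have 24: "i2 * n4 + i4 < n2 * n4" using assms by (intro pair_index_less)
  have "?k < n1 * n3 * (n2 * n4)" using assms 24 by (intro pair_index_less)
  moreover have "?k div (n2 * n4) = i1 * n3 + i3" by (rule pair_index_div[OF 24])
  moreover have eq: "?k = ((i1 * n3 + i3) * n2 + i2) * n4 + i4" by (simp add: algebra_simps)
  have "?k mod n4 = i4" "?k div n4 mod n2 = i2" unfolding eq using assms by simp_all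
  ultimately show ?thesis using assms by (simp add: swap_middle_def Let_def)
qed

lemma swap_middle_carrier: "swap_middle n1 n2 n3 n4 v \<in> carrier_vec (n1 * n3 * (n2 * n4))"
  by (simp add: swap_middle_def)

lemma mult_mat_vec_index_sum:
  assumes "A \<in> carrier_mat n m" "v \<in> carrier_vec m" "i < n"
  shows "(A *\<^sub>v v) $ i = (\<Sum>k<m. A $$ (i, k) * v $ k)"
  using assms by (simp add: scalar_prod_def atLeast0LessThan)

lemma mat_adjoint_mult_index:
  assumes "E \<in> carrier_mat n m" "P < m" "Q < m"
  shows "(mat_adjoint E * E) $$ (P, Q) = (\<Sum>i<n. cnj (E $$ (i, P)) * E $$ (i, Q))"
  using assms by (simp add: mat_adjoint_def mat_of_rows_def scalar_prod_def atLeast0LessThan)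

lemma mat_adjoint_mult_carrier:
  "E \<in> carrier_mat n m \<Longrightarrow> mat_adjoint E * E \<in> carrier_mat m m"
  by (auto simp: mat_adjoint_def mat_of_rows_def)

lemma inner_prod_ip:
  assumes "v \<in> carrier_vec n" "w \<in> carrier_vec n"
  shows "v \<bullet>c w = ip {..<n} (\<lambda>i. w $ i) (\<lambda>i. v $ i)"
  using assms by (simp add: scalar_prod_def ip_def atLeast0LessThan mult.commute)

lemma orthonormal_list_iff:
  assumes "set vs \<subseteq> carrier_vec n"
  shows "orthonormal_list n vs \<longleftrightarrow> orthonormal_on {..<n} (length vs) (\<lambda>k i. vs ! k $ i)"
proof -
  have "vs ! i \<bullet>c vs ! j = (if i = j then 1 else 0) \<longleftrightarrow>
      ip {..<n} (\<lambda>l. vs ! j $ l) (\<lambda>l. vs ! i $ l) = (if j = i then 1 else 0)"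
    if "i < length vs" "j < length vs" for i j
  proof -
    have "vs ! i \<bullet>c vs ! j = ip {..<n} (\<lambda>l. vs ! j $ l) (\<lambda>l. vs ! i $ l)"
      using that assms by (intro inner_prod_ip) (auto simp: subset_iff)
    then show ?thesis by auto
  qed
  then show ?thesis using assms
    unfolding orthonormal_list_def orthonormal_on_def by blast
qed

lemma normalized_state_nrm2:
  assumes "normalized_state n v"
  shows "nrm2 {..<n} (\<lambda>i. v $ i) = 1"
  using assms inner_prod_ip[of v n v] by (simp add: normalized_state_def ip_self)

lemma finsum_tensor_index:
  assumes "finite K" "\<And>k. k \<in> K \<Longrightarrow> v k \<in> carrier_vec n \<and> w k \<in> carrier_vec m" "i < n" "j < m"
  shows "finsum_vec TYPE(complex) (n * m) (\<lambda>k. c k \<cdot>\<^sub>v tensor_vec (v k) (w k)) K $ (i * m + j)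
         = (\<Sum>k\<in>K. c k * (v k $ i * w k $ j))"
proof -
  have "finsum_vec TYPE(complex) (n * m) (\<lambda>k. c k \<cdot>\<^sub>v tensor_vec (v k) (w k)) K $ (i * m + j)
      = (\<Sum>k\<in>K. (c k \<cdot>\<^sub>v tensor_vec (v k) (w k)) $ (i * m + j))"
    using assms(1,3,4)
    by (intro index_finsum_vec pair_index_less)
      (auto intro!: tensor_vec_carrier assms(2)[THEN conjunct1] assms(2)[THEN conjunct2])
  also have "\<dots> = (\<Sum>k\<in>K. c k * (v k $ i * w k $ j))"
  proof (intro sum.cong refl)
    fix k assume k: "k \<in> K"
    have "tensor_vec (v k) (w k) \<in> carrier_vec (n * m)"
      using assms(2)[OF k] by (intro tensor_vec_carrier) auto
    then show "(c k \<cdot>\<^sub>v tensor_vec (v k) (w k)) $ (i * m + j) = c k * (v k $ i * w k $ j)"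
      using assms(2)[OF k] assms(3,4) pair_index_less[of i n j m]
      by (simp add: tensor_vec_index[of _ n _ m])
  qed
  finally show ?thesis .
qed

lemma finsum_tensor_carrier:
  assumes "\<And>k. k \<in> K \<Longrightarrow> v k \<in> carrier_vec n \<and> w k \<in> carrier_vec m"
  shows "finsum_vec TYPE(complex) (n * m) (\<lambda>k. c k \<cdot>\<^sub>v tensor_vec (v k) (w k)) K \<in> carrier_vec (n * m)"
  by (intro finsum_vec_closed)
    (auto intro!: tensor_vec_carrier assms[THEN conjunct1] assms[THEN conjunct2])

lemma vec_eq_pair_index:
  assumes "v \<in> carrier_vec (n * m)" "w \<in> carrier_vec (n * m)"
    and "\<And>i j. i < n \<Longrightarrow> j < m \<Longrightarrow> v $ (i * m + j) = w $ (i * m + j)"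
  shows "v = w"
proof (rule eq_vecI)
  fix k assume "k < dim_vec w"
  then have k: "k < n * m" using assms by simp
  then have "m > 0" by (auto intro: gr0I)
  then have "k mod m < m" "k div m < n" using k by (auto simp: less_mult_imp_div_less)
  from assms(3)[OF this(2,1)] show "v $ k = w $ k" by simp
qed (use assms in simp)

section \<open>Schmidt decompositions in coordinates\<close>

lemma schmidt_decompositionD:
  assumes "schmidt_decomposition n m \<psi> s e f"
  shows "orthonormal_on {..<n} (length s) (\<lambda>k i. e ! k $ i)"
    and "orthonormal_on {..<m} (length s) (\<lambda>k i. f ! k $ i)"
    and "\<And>k. k < length s \<Longrightarrow> s ! k > 0"
    and "\<And>i j. i < n \<Longrightarrow> j < m \<Longrightarrow>
      \<psi> $ (i * m + j) = (\<Sum>k<length s. complex_of_real (s ! k) * (e ! k $ i * f ! k $ j))"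
proof -
  note a = assms[unfolded schmidt_decomposition_def]
  have l: "length e = length s" "length f = length s" using a by auto
  have c: "set e \<subseteq> carrier_vec n" "set f \<subseteq> carrier_vec m" using a by (auto simp: orthonormal_list_def)
  show "orthonormal_on {..<n} (length s) (\<lambda>k i. e ! k $ i)"
    using a orthonormal_list_iff[OF c(1)] l by auto
  show "orthonormal_on {..<m} (length s) (\<lambda>k i. f ! k $ i)"
    using a orthonormal_list_iff[OF c(2)] l by auto
  show "s ! k > 0" if "k < length s" for k using a that by auto
  have c': "e ! k \<in> carrier_vec n \<and> f ! k \<in> carrier_vec m" if "k \<in> {..<length s}" for k
    using c l that by (auto simp: subset_iff)
  show "\<psi> $ (i * m + j) = (\<Sum>k<length s. complex_of_real (s ! k) * (e ! k $ i * f ! k $ j))"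
    if "i < n" "j < m" for i j
    using a finsum_tensor_index[where c = "\<lambda>k. complex_of_real (s ! k)" and v = "(!) e" and w = "(!) f",
        OF finite_lessThan c' that] by simp
qed

lemma schmidt_decomposition_exists:
  assumes "\<psi> \<in> carrier_vec (n * m)"
  shows "\<exists>s e f. schmidt_decomposition n m \<psi> s e f"
proof -
  from schmidt_decomposition_on[of "{..<m}" n "\<lambda>i j. \<psi> $ (i * m + j)"]
  obtain r s e f where o: "orthonormal_on {..<n} r e" "orthonormal_on {..<m} r f" and s: "\<forall>k<r. s k > 0"
    and \<psi>: "\<forall>i<n. \<forall>j<m. \<psi> $ (i * m + j) = (\<Sum>k<r. complex_of_real (s k) * (e k i * f k j))"
    by auto
  define S where "S = map s [0..<r]"
  define Es where "Es = map (\<lambda>k. vec n (e k)) [0..<r]"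
  define Fs where "Fs = map (\<lambda>k. vec m (f k)) [0..<r]"
  have c: "set Es \<subseteq> carrier_vec n" "set Fs \<subseteq> carrier_vec m" by (auto simp: Es_def Fs_def)
  have oe: "orthonormal_on {..<n} r (\<lambda>k i. Es ! k $ i)"
    using o(1) unfolding orthonormal_on_def ip_def Es_def by simp
  have of: "orthonormal_on {..<m} r (\<lambda>k i. Fs ! k $ i)"
    using o(2) unfolding orthonormal_on_def ip_def Fs_def by simp
  have c': "Es ! k \<in> carrier_vec n \<and> Fs ! k \<in> carrier_vec m" if "k \<in> {..<r}" for k
    using that by (simp add: Es_def Fs_def)
  have "\<psi> = finsum_vec TYPE(complex) (n * m)
           (\<lambda>j. complex_of_real (S ! j) \<cdot>\<^sub>v tensor_vec (Es ! j) (Fs ! j)) {..<r}"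
  proof (rule vec_eq_pair_index[OF assms finsum_tensor_carrier[OF c']])
    fix i j assume ij: "i < n" "j < m"
    show "\<psi> $ (i * m + j) = finsum_vec TYPE(complex) (n * m)
           (\<lambda>j. complex_of_real (S ! j) \<cdot>\<^sub>v tensor_vec (Es ! j) (Fs ! j)) {..<r} $ (i * m + j)"
      using \<psi> ij finsum_tensor_index[where c = "\<lambda>k. complex_of_real (S ! k)" and v = "(!) Es" and w = "(!) Fs",
          OF finite_lessThan c' ij]
      by (simp add: S_def Es_def Fs_def)
  qed
  then have "schmidt_decomposition n m \<psi> S Es Fs"
    unfolding schmidt_decomposition_def orthonormal_list_iff[OF c(1)] orthonormal_list_iff[OF c(2)]
    using oe of s by (auto simp: S_def Es_def Fs_def)
  then show ?thesis by blast
qed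

text \<open>The choice in \<open>schmidt_coeffs\<close> ranges over a nonempty set, so
  \<open>entanglement\<close> is evaluated on an actual decomposition, to which the majorization
  argument applies.\<close>

lemma schmidt_coeffs_decomposition:
  assumes "\<psi> \<in> carrier_vec (n * m)"
  shows "\<exists>e f. schmidt_decomposition n m \<psi> (schmidt_coeffs n m \<psi>) e f"
  unfolding schmidt_coeffs_def by (rule someI_ex) (rule schmidt_decomposition_exists[OF assms])

lemma entanglement_eq:
  "entanglement n m \<psi> = - (\<Sum>k<length (schmidt_coeffs n m \<psi>).
      (schmidt_coeffs n m \<psi> ! k)\<^sup>2 * ln ((schmidt_coeffs n m \<psi> ! k)\<^sup>2))"
  by (simp add: entanglement_def sum_list_sum_nth atLeast0LessThan)

section \<open>The branches of a separable operation\<close>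

lemma sum_swap4:
  "(\<Sum>i\<in>A. \<Sum>x\<in>B. \<Sum>P\<in>C. \<Sum>Q\<in>D. f i x P Q) = (\<Sum>P\<in>C. \<Sum>Q\<in>D. \<Sum>x\<in>B. \<Sum>i\<in>A. f i x P Q)"
proof -
  have "(\<Sum>i\<in>A. \<Sum>x\<in>B. \<Sum>P\<in>C. \<Sum>Q\<in>D. f i x P Q) = (\<Sum>i\<in>A. \<Sum>P\<in>C. \<Sum>x\<in>B. \<Sum>Q\<in>D. f i x P Q)"
    by (intro sum.cong refl sum.swap)
  also have "\<dots> = (\<Sum>P\<in>C. \<Sum>i\<in>A. \<Sum>x\<in>B. \<Sum>Q\<in>D. f i x P Q)" by (rule sum.swap)
  also have "\<dots> = (\<Sum>P\<in>C. \<Sum>i\<in>A. \<Sum>Q\<in>D. \<Sum>x\<in>B. f i x P Q)"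
    by (intro sum.cong refl sum.swap)
  also have "\<dots> = (\<Sum>P\<in>C. \<Sum>Q\<in>D. \<Sum>i\<in>A. \<Sum>x\<in>B. f i x P Q)"
    by (intro sum.cong refl sum.swap)
  also have "\<dots> = (\<Sum>P\<in>C. \<Sum>Q\<in>D. \<Sum>x\<in>B. \<Sum>i\<in>A. f i x P Q)"
    by (intro sum.cong refl sum.swap)
  finally show ?thesis .
qed

lemma sum_delta_pair:
  "finite S \<Longrightarrow> (\<Sum>P\<in>S. \<Sum>Q\<in>S. W P Q * (if P = Q then 1 else 0)) = (\<Sum>P\<in>S. W P P :: complex)"
  by (intro sum.cong refl) (simp add: if_distrib[of "\<lambda>x. _ * x"] cong: if_cong)

text \<open>\<open>G m\<close> and \<open>H m\<close> will be the matrices of \<open>E m\<close> and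
  \<open>F m\<close> multiplied by their adjoints, and \<open>comp\<close> says that their tensor
  products sum to the identity. Contraction with the identity leaves only the diagonal entries of
  \<open>V\<close> and \<open>W\<close>.\<close>

lemma sum_contract:
  fixes G :: "'m \<Rightarrow> 'p \<Rightarrow> 'p \<Rightarrow> complex" and H :: "'m \<Rightarrow> 'q \<Rightarrow> 'q \<Rightarrow> complex"
  assumes fin: "finite S" "finite R"
    and comp: "\<And>P P' Q Q'. P \<in> S \<Longrightarrow> P' \<in> S \<Longrightarrow> Q \<in> R \<Longrightarrow> Q' \<in> R \<Longrightarrow>
      (\<Sum>m\<in>N. G m P P' * H m Q Q') = (if P = P' \<and> Q = Q' then 1 else 0)"
  shows "(\<Sum>m\<in>N. (\<Sum>P\<in>S. \<Sum>P'\<in>S. V P P' * G m P P') * (\<Sum>Q\<in>R. \<Sum>Q'\<in>R. W Q Q' * H m Q Q'))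
         = (\<Sum>P\<in>S. V P P) * (\<Sum>Q\<in>R. W Q Q)"
proof -
  have "(\<Sum>m\<in>N. (\<Sum>P\<in>S. \<Sum>P'\<in>S. V P P' * G m P P') * (\<Sum>Q\<in>R. \<Sum>Q'\<in>R. W Q Q' * H m Q Q'))
      = (\<Sum>m\<in>N. \<Sum>x\<in>S \<times> S. \<Sum>y\<in>R \<times> R. (V (fst x) (snd x) * G m (fst x) (snd x)) * (W (fst y) (snd y) * H m (fst y) (snd y)))"
    by (simp only: sum.cartesian_product case_prod_unfold sum_product)
  also have "\<dots> = (\<Sum>x\<in>S \<times> S. \<Sum>m\<in>N. \<Sum>y\<in>R \<times> R. (V (fst x) (snd x) * G m (fst x) (snd x)) * (W (fst y) (snd y) * H m (fst y) (snd y)))"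
    by (rule sum.swap)
  also have "\<dots> = (\<Sum>x\<in>S \<times> S. \<Sum>y\<in>R \<times> R. \<Sum>m\<in>N. (V (fst x) (snd x) * G m (fst x) (snd x)) * (W (fst y) (snd y) * H m (fst y) (snd y)))"
    by (intro sum.cong refl sum.swap)
  also have "\<dots> = (\<Sum>x\<in>S \<times> S. \<Sum>y\<in>R \<times> R. (V (fst x) (snd x) * (if fst x = snd x then 1 else 0)) * (W (fst y) (snd y) * (if fst y = snd y then 1 else 0)))"
  proof (intro sum.cong refl)
    fix x y assume xy: "x \<in> S \<times> S" "y \<in> R \<times> R"
    have "(\<Sum>m\<in>N. (V (fst x) (snd x) * G m (fst x) (snd x)) * (W (fst y) (snd y) * H m (fst y) (snd y)))
        = V (fst x) (snd x) * W (fst y) (snd y) * (\<Sum>m\<in>N. G m (fst x) (snd x) * H m (fst y) (snd y))"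
      by (simp add: sum_distrib_left mult_ac)
    also have "(\<Sum>m\<in>N. G m (fst x) (snd x) * H m (fst y) (snd y)) =
        (if fst x = snd x \<and> fst y = snd y then 1 else 0)"
      using xy by (intro comp) auto
    finally show "(\<Sum>m\<in>N. (V (fst x) (snd x) * G m (fst x) (snd x)) * (W (fst y) (snd y) * H m (fst y) (snd y)))
        = (V (fst x) (snd x) * (if fst x = snd x then 1 else 0)) * (W (fst y) (snd y) * (if fst y = snd y then 1 else 0))"
      by simp
  qed
  also have "\<dots> = (\<Sum>P\<in>S. \<Sum>P'\<in>S. V P P' * (if P = P' then 1 else 0)) * (\<Sum>Q\<in>R. \<Sum>Q'\<in>R. W Q Q' * (if Q = Q' then 1 else 0))"
    by (simp only: sum.cartesian_product case_prod_unfold sum_product)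
  finally show ?thesis unfolding sum_delta_pair[OF fin(1)] sum_delta_pair[OF fin(2)] .
qed

text \<open>
  With E acting on \<open>a \<otimes> A\<close>, \<^term>\<open>branch_op da dA E e\<close> is the matrix of \<open>v \<mapsto> E (e \<otimes> v)\<close>, and
  \<^term>\<open>branch_vec da dA p E e \<sigma>\<close> is \<open>(E \<otimes> I) (e \<otimes> \<sigma>)\<close> for a state \<open>\<sigma>\<close> of A and an ancilla of
  dimension p. The coefficient of the output of U at \<open>(I, J)\<close>, with both local indices including the
  ancilla, is \<open>output_fun\<close>.
\<close>

definition branch_op :: "nat \<Rightarrow> nat \<Rightarrow> (nat \<Rightarrow> nat \<Rightarrow> complex) \<Rightarrow> (nat \<Rightarrow> complex) \<Rightarrow> nat \<Rightarrow> nat \<Rightarrow> complex" where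
  "branch_op da dA E e i l = (\<Sum>k<da. E i (k * dA + l) * e k)"

definition branch_vec ::
  "nat \<Rightarrow> nat \<Rightarrow> nat \<Rightarrow> (nat \<Rightarrow> nat \<Rightarrow> complex) \<Rightarrow> (nat \<Rightarrow> complex) \<Rightarrow> (nat \<Rightarrow> complex) \<Rightarrow> nat \<Rightarrow> complex" where
  "branch_vec da dA p E e \<sigma> I = (\<Sum>l<dA. branch_op da dA E e (I div p) l * \<sigma> (l * p + I mod p))"

lemma branch_vec_pair_index:
  assumes "x < p"
  shows "branch_vec da dA p E e \<sigma> (i * p + x) =
    (\<Sum>P<da * dA. E i P * (e (P div dA) * \<sigma> (P mod dA * p + x)))"
  unfolding branch_vec_def branch_op_def sum_distrib_right sum_pair_index
  by (subst sum.swap) (use assms in \<open>simp add: mult_ac\<close>)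

text \<open>Brings the inner product into the form that \<open>sum_contract\<close> consumes:
  \<open>P\<close> and \<open>Q\<close> are joint indices of resource and input, the ancilla sum
  goes into the coefficient, and the last sum is the Gram kernel of \<open>E\<close>.\<close>

lemma ip_branch_vec:
  "ip {..<dA * p} (branch_vec da dA p E e \<sigma>) (branch_vec da dA p E e' \<sigma>) =
    (\<Sum>P<da * dA. \<Sum>Q<da * dA.
      (\<Sum>x<p. cnj (e (P div dA) * \<sigma> (P mod dA * p + x)) * (e' (Q div dA) * \<sigma> (Q mod dA * p + x))) *
      (\<Sum>i<dA. cnj (E i P) * E i Q))"
proof -
  have "ip {..<dA * p} (branch_vec da dA p E e \<sigma>) (branch_vec da dA p E e' \<sigma>) =
    (\<Sum>i<dA. \<Sum>x<p. \<Sum>P<da * dA. \<Sum>Q<da * dA.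
      cnj (E i P * (e (P div dA) * \<sigma> (P mod dA * p + x))) * (E i Q * (e' (Q div dA) * \<sigma> (Q mod dA * p + x))))"
    unfolding ip_def sum_pair_index[of _ dA p]
    by (intro sum.cong refl) (simp only: lessThan_iff branch_vec_pair_index cnj_sum sum_product)
  also have "\<dots> = (\<Sum>P<da * dA. \<Sum>Q<da * dA. \<Sum>x<p. \<Sum>i<dA.
      cnj (E i P * (e (P div dA) * \<sigma> (P mod dA * p + x))) * (E i Q * (e' (Q div dA) * \<sigma> (Q mod dA * p + x))))"
    by (rule sum_swap4)
  also have "\<dots> = (\<Sum>P<da * dA. \<Sum>Q<da * dA.
      (\<Sum>x<p. cnj (e (P div dA) * \<sigma> (P mod dA * p + x)) * (e' (Q div dA) * \<sigma> (Q mod dA * p + x))) *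
      (\<Sum>i<dA. cnj (E i P) * E i Q))"
    unfolding sum_product by (simp add: mult_ac)
  finally show ?thesis .
qed

text \<open>What the contraction leaves of \<open>ip_branch_vec\<close>: input and ancilla
  contribute the norm of \<sigma>, and the resource vectors their inner product.\<close>

lemma branch_vec_trace:
  fixes da dA p :: nat
  shows "(\<Sum>P<da * dA. \<Sum>x<p. cnj (e (P div dA) * \<sigma> (P mod dA * p + x)) * (e' (P div dA) * \<sigma> (P mod dA * p + x)))
   = ip {..<da} e e' * complex_of_real (nrm2 {..<dA * p} \<sigma>)"
proof -
  have "(\<Sum>P<da * dA. \<Sum>x<p. cnj (e (P div dA) * \<sigma> (P mod dA * p + x)) * (e' (P div dA) * \<sigma> (P mod dA * p + x)))
      = (\<Sum>i<da. \<Sum>l<dA. \<Sum>x<p. (cnj (e i) * e' i) * (cnj (\<sigma> (l * p + x)) * \<sigma> (l * p + x)))"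
    unfolding sum_pair_index[of _ da dA] by (intro sum.cong refl) (simp add: mult_ac)
  also have "\<dots> = ip {..<da} e e' * ip {..<dA * p} \<sigma> \<sigma>"
    unfolding ip_def sum_pair_index[of _ dA p] sum_distrib_right unfolding sum_distrib_left ..
  finally show ?thesis by (simp add: ip_self)
qed

text \<open>Supplies the relation \<open>comp\<close> of \<open>schmidt_majorization\<close>: the
  completeness of the operation preserves, in total over the branches, the inner products of Schmidt
  terms tensored with the fixed input.\<close>

lemma branch_gram:
  fixes E F :: "nat \<Rightarrow> nat \<Rightarrow> nat \<Rightarrow> complex"
  assumes comp: "\<And>P P' Q Q'. P < da * dA \<Longrightarrow> P' < da * dA \<Longrightarrow> Q < db * dB \<Longrightarrow> Q' < db * dB \<Longrightarrow>
      (\<Sum>m<M. (\<Sum>i<dA. cnj (E m i P) * E m i P') * (\<Sum>j<dB. cnj (F m j Q) * F m j Q'))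
      = (if P = P' \<and> Q = Q' then 1 else 0)"
    and e: "orthonormal_on {..<da} r e" and f: "orthonormal_on {..<db} r f"
    and \<sigma>: "nrm2 {..<dA * p} \<sigma> = 1" and \<tau>: "nrm2 {..<dB * q} \<tau> = 1"
    and kl: "k < r" "l < r"
  shows "(\<Sum>m<M. ip {..<dA * p} (branch_vec da dA p (E m) (e k) \<sigma>) (branch_vec da dA p (E m) (e l) \<sigma>) *
                ip {..<dB * q} (branch_vec db dB q (F m) (f k) \<tau>) (branch_vec db dB q (F m) (f l) \<tau>))
         = (if k = l then 1 else 0)"
proof -
  have c: "(\<Sum>m<M. (\<Sum>i<dA. cnj (E m i P) * E m i P') * (\<Sum>j<dB. cnj (F m j Q) * F m j Q'))
      = (if P = P' \<and> Q = Q' then 1 else 0)"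
    if "P \<in> {..<da * dA}" "P' \<in> {..<da * dA}" "Q \<in> {..<db * dB}" "Q' \<in> {..<db * dB}" for P P' Q Q'
    using comp that by simp
  show ?thesis
    unfolding ip_branch_vec
    by (rule trans[OF sum_contract[OF finite_lessThan finite_lessThan c]])
      (use kl \<sigma> \<tau> in \<open>simp_all only: branch_vec_trace orthonormal_onD[OF e] orthonormal_onD[OF f], simp_all\<close>)
qed

lemma branch_op_expand:
  assumes "\<And>a b. a < da \<Longrightarrow> b < db \<Longrightarrow> \<phi> a b = (\<Sum>k<r. s k * (e k a * f k b))"
  shows "(\<Sum>a<da. \<Sum>b<db. E i (a * dA + i') * F j (b * dB + j') * \<phi> a b)
    = (\<Sum>k<r. s k * (branch_op da dA E (e k) i i' * branch_op db dB F (f k) j j'))"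
proof -
  have "(\<Sum>a<da. \<Sum>b<db. E i (a * dA + i') * F j (b * dB + j') * \<phi> a b)
      = (\<Sum>a<da. \<Sum>b<db. \<Sum>k<r. s k * ((E i (a * dA + i') * e k a) * (F j (b * dB + j') * f k b)))"
    by (intro sum.cong refl) (simp add: assms sum_distrib_left mult_ac)
  also have "\<dots> = (\<Sum>a<da. \<Sum>k<r. \<Sum>b<db. s k * ((E i (a * dA + i') * e k a) * (F j (b * dB + j') * f k b)))"
    by (intro sum.cong refl sum.swap)
  also have "\<dots> = (\<Sum>k<r. \<Sum>a<da. \<Sum>b<db. s k * ((E i (a * dA + i') * e k a) * (F j (b * dB + j') * f k b)))"
    by (rule sum.swap)
  finally show ?thesis unfolding branch_op_def sum_product unfolding sum_distrib_left .
qed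

definition output_fun ::
  "nat \<Rightarrow> nat \<Rightarrow> nat \<Rightarrow> nat \<Rightarrow> (nat \<Rightarrow> nat \<Rightarrow> nat \<Rightarrow> nat \<Rightarrow> complex) \<Rightarrow> (nat \<Rightarrow> complex) \<Rightarrow> (nat \<Rightarrow> complex) \<Rightarrow> nat \<times> nat \<Rightarrow> complex" where
  "output_fun dA dB p q u \<sigma> \<tau> = (\<lambda>(I, J). \<Sum>k<dA. \<Sum>l<dB.
     u (I div p) (J div q) k l * (\<sigma> (k * p + I mod p) * \<tau> (l * q + J mod q)))"

lemma branch_output:
  assumes "\<And>k l. k < dA \<Longrightarrow> l < dB \<Longrightarrow> c * u (I div p) (J div q) k l =
     (\<Sum>n<r. s n * (branch_op da dA E (e n) (I div p) k * branch_op db dB F (f n) (J div q) l))"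
  shows "c * output_fun dA dB p q u \<sigma> \<tau> (I, J)
    = (\<Sum>n<r. s n * (branch_vec da dA p E (e n) \<sigma> I * branch_vec db dB q F (f n) \<tau> J))"
proof -
  let ?S = "\<lambda>k. \<sigma> (k * p + I mod p)" and ?T = "\<lambda>l. \<tau> (l * q + J mod q)"
  let ?A = "\<lambda>n k. branch_op da dA E (e n) (I div p) k" and ?B = "\<lambda>n l. branch_op db dB F (f n) (J div q) l"
  have "c * output_fun dA dB p q u \<sigma> \<tau> (I, J) = (\<Sum>k<dA. \<Sum>l<dB. (c * u (I div p) (J div q) k l) * (?S k * ?T l))"
    by (simp add: output_fun_def sum_distrib_left mult.assoc)
  also have "\<dots> = (\<Sum>k<dA. \<Sum>l<dB. \<Sum>n<r. s n * ((?A n k * ?S k) * (?B n l * ?T l)))"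
    by (intro sum.cong refl, simp only: lessThan_iff assms sum_distrib_right, simp add: mult_ac)
  also have "\<dots> = (\<Sum>k<dA. \<Sum>n<r. \<Sum>l<dB. s n * ((?A n k * ?S k) * (?B n l * ?T l)))"
    by (intro sum.cong refl sum.swap)
  also have "\<dots> = (\<Sum>n<r. \<Sum>k<dA. \<Sum>l<dB. s n * ((?A n k * ?S k) * (?B n l * ?T l)))"
    by (rule sum.swap)
  finally show ?thesis unfolding branch_vec_def sum_product unfolding sum_distrib_left .
qed

text \<open>For fixed ancilla indices \<open>x\<close> and \<open>y\<close> the output is a
  combination of the orthonormal columns of \<open>u\<close>, with the entries of the product input
  as coefficients.\<close>

lemma nrm2_output_fun:
  assumes u: "orthonormal_on {..<dA * dB} (dA * dB) (\<lambda>L K. u (K div dB) (K mod dB) (L div dB) (L mod dB))"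
    and \<sigma>: "nrm2 {..<dA * p} \<sigma> = 1" and \<tau>: "nrm2 {..<dB * q} \<tau> = 1"
  shows "nrm2 ({..<dA * p} \<times> {..<dB * q}) (output_fun dA dB p q u \<sigma> \<tau>) = 1"
proof -
  let ?v = "\<lambda>i x j y. \<Sum>k<dA. \<Sum>l<dB. (\<sigma> (k * p + x) * \<tau> (l * q + y)) * u i j k l"
  have "nrm2 ({..<dA * p} \<times> {..<dB * q}) (output_fun dA dB p q u \<sigma> \<tau>)
      = (\<Sum>I<dA * p. \<Sum>J<dB * q. (cmod (output_fun dA dB p q u \<sigma> \<tau> (I, J)))\<^sup>2)"
    by (simp add: nrm2_def sum.cartesian_product case_prod_unfold)
  also have "\<dots> = (\<Sum>i<dA. \<Sum>x<p. \<Sum>j<dB. \<Sum>y<q. (cmod (?v i x j y))\<^sup>2)"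
    unfolding sum_pair_index by (intro sum.cong refl) (simp add: output_fun_def mult.commute)
  also have "\<dots> = (\<Sum>i<dA. \<Sum>j<dB. \<Sum>x<p. \<Sum>y<q. (cmod (?v i x j y))\<^sup>2)"
    by (intro sum.cong refl sum.swap)
  also have "\<dots> = (\<Sum>x<p. \<Sum>y<q. \<Sum>j<dB. \<Sum>i<dA. (cmod (?v i x j y))\<^sup>2)"
    by (rule sum_swap4)
  also have "\<dots> = (\<Sum>x<p. \<Sum>y<q. \<Sum>i<dA. \<Sum>j<dB. (cmod (?v i x j y))\<^sup>2)"
    by (intro sum.cong refl sum.swap)
  also have "\<dots> = (\<Sum>x<p. \<Sum>y<q. nrm2 {..<dA * dB} (\<lambda>K. \<Sum>L<dA * dB.
      (\<sigma> (L div dB * p + x) * \<tau> (L mod dB * q + y)) * u (K div dB) (K mod dB) (L div dB) (L mod dB)))"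
    unfolding nrm2_def sum_pair_index by simp
  also have "\<dots> = (\<Sum>x<p. \<Sum>y<q. \<Sum>L<dA * dB. (cmod (\<sigma> (L div dB * p + x) * \<tau> (L mod dB * q + y)))\<^sup>2)"
    by (simp only: nrm2_orthonormal_sum[OF u])
  also have "\<dots> = (\<Sum>x<p. \<Sum>y<q. \<Sum>k<dA. \<Sum>l<dB. (cmod (\<sigma> (k * p + x)))\<^sup>2 * (cmod (\<tau> (l * q + y)))\<^sup>2)"
    unfolding sum_pair_index by (simp add: norm_mult power_mult_distrib)
  also have "\<dots> = (\<Sum>k<dA. \<Sum>l<dB. \<Sum>y<q. \<Sum>x<p. (cmod (\<sigma> (k * p + x)))\<^sup>2 * (cmod (\<tau> (l * q + y)))\<^sup>2)"
    by (rule sum_swap4)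
  also have "\<dots> = (\<Sum>k<dA. \<Sum>l<dB. \<Sum>x<p. \<Sum>y<q. (cmod (\<sigma> (k * p + x)))\<^sup>2 * (cmod (\<tau> (l * q + y)))\<^sup>2)"
    by (intro sum.cong refl sum.swap)
  also have "\<dots> = nrm2 {..<dA * p} \<sigma> * nrm2 {..<dB * q} \<tau>"
    unfolding nrm2_def sum_pair_index by (simp only: sum_product)
  finally show ?thesis using \<sigma> \<tau> by simp
qed

section \<open>Index form of the matrix definitions\<close>

lemma pair_index_eq_iff:
  "j < m \<Longrightarrow> j' < m \<Longrightarrow> i * m + j = i' * m + j' \<longleftrightarrow> i = i' \<and> j = (j'::nat)"
  by (metis pair_index_div add_left_cancel)

lemma tensor_mat_one: "tensor_mat (1\<^sub>m p) (1\<^sub>m q) = 1\<^sub>m (p * q)"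
proof (rule eq_matI)
  fix i j assume "i < dim_row (1\<^sub>m (p * q) :: complex mat)" "j < dim_col (1\<^sub>m (p * q) :: complex mat)"
  then have ij: "i < p * q" "j < p * q" by auto
  then have "q > 0" by (auto intro: gr0I)
  then have "i div q < p" "j div q < p" "i mod q < q" "j mod q < q"
    using ij by (auto simp: less_mult_imp_div_less)
  moreover have "i div q = j div q \<and> i mod q = j mod q \<longleftrightarrow> i = j" by (metis div_mult_mod_eq)
  ultimately show "tensor_mat (1\<^sub>m p) (1\<^sub>m q) $$ (i, j) = (1\<^sub>m (p * q) :: complex mat) $$ (i, j)"
    using ij by (auto simp: tensor_mat_def)
qed (auto simp: tensor_mat_def)

lemma tensor_mat_mult_vec_index:
  assumes "A \<in> carrier_mat n n'" "B \<in> carrier_mat m m'" "v \<in> carrier_vec (n' * m')" "i < n" "j < m"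
  shows "(tensor_mat A B *\<^sub>v v) $ (i * m + j) = (\<Sum>k<n'. \<Sum>l<m'. A $$ (i, k) * B $$ (j, l) * v $ (k * m' + l))"
  unfolding mult_mat_vec_index_sum[OF tensor_mat_carrier[OF assms(1,2)] assms(3) pair_index_less[OF assms(4,5)]]
    sum_pair_index
  by (intro sum.cong refl) (simp add: tensor_mat_index[OF assms(1,2,4,5)])

lemma resource_input_index:
  assumes "\<Phi> \<in> carrier_vec (da * db)" "\<Psi> \<in> carrier_vec (dA * dB)" "a < da" "k < dA" "b < db" "l < dB"
  shows "swap_middle da db dA dB (tensor_vec \<Phi> \<Psi>) $ ((a * dA + k) * (db * dB) + (b * dB + l))
    = \<Phi> $ (a * db + b) * \<Psi> $ (k * dB + l)"
  unfolding swap_middle_index[OF assms(3,5,4,6)]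
  by (rule tensor_vec_index[OF assms(1,2) pair_index_less[OF assms(3,5)] pair_index_less[OF assms(4,6)]])

text \<open>\<open>gen\<close> is tested on the basis vector with index \<open>i' * dB + j'\<close>,
  which selects one column of \<open>U\<close> and, for each resource index, the matching columns of
  \<open>E\<close> and \<open>F\<close>.\<close>

lemma separable_branch_index:
  assumes U: "U \<in> carrier_mat (dA * dB) (dA * dB)" and \<Phi>: "\<Phi> \<in> carrier_vec (da * db)"
    and E: "E \<in> carrier_mat dA (da * dA)" and F: "F \<in> carrier_mat dB (db * dB)"
    and gen: "\<And>\<Psi>. \<Psi> \<in> carrier_vec (dA * dB) \<Longrightarrow>
      tensor_mat E F *\<^sub>v swap_middle da db dA dB (tensor_vec \<Phi> \<Psi>) = c \<cdot>\<^sub>v (U *\<^sub>v \<Psi>)"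
    and ij: "i < dA" "j < dB" "i' < dA" "j' < dB"
  shows "c * U $$ (i * dB + j, i' * dB + j')
    = (\<Sum>a<da. \<Sum>b<db. E $$ (i, a * dA + i') * F $$ (j, b * dB + j') * \<Phi> $ (a * db + b))"
proof -
  define N where "N = i' * dB + j'"
  have N: "N < dA * dB" unfolding N_def using ij by (intro pair_index_less)
  define \<Psi> where "\<Psi> = (unit_vec (dA * dB) N :: complex vec)"
  have \<Psi>: "\<Psi> \<in> carrier_vec (dA * dB)" by (simp add: \<Psi>_def)
  have \<Psi>_index: "\<Psi> $ (k * dB + l) = (if k = i' then if l = j' then 1 else 0 else 0)" if "k < dA" "l < dB" for k l
    using pair_index_less[OF that] pair_index_eq_iff[OF that(2) ij(4), of k i'] N by (auto simp: \<Psi>_def N_def)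
  have "(U *\<^sub>v \<Psi>) $ (i * dB + j) = (\<Sum>K<dA * dB. if K = N then U $$ (i * dB + j, N) else 0)"
    unfolding mult_mat_vec_index_sum[OF U \<Psi> pair_index_less[OF ij(1,2)]]
    using N by (intro sum.cong refl) (simp add: \<Psi>_def)
  then have "(c \<cdot>\<^sub>v (U *\<^sub>v \<Psi>)) $ (i * dB + j) = c * U $$ (i * dB + j, N)"
    using U N pair_index_less[OF ij(1,2)] by simp
  then have "c * U $$ (i * dB + j, N) = (tensor_mat E F *\<^sub>v swap_middle da db dA dB (tensor_vec \<Phi> \<Psi>)) $ (i * dB + j)"
    by (simp add: gen[OF \<Psi>])
  also have "\<dots> = (\<Sum>P<da * dA. \<Sum>Q<db * dB. E $$ (i, P) * F $$ (j, Q) *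
      swap_middle da db dA dB (tensor_vec \<Phi> \<Psi>) $ (P * (db * dB) + Q))"
    by (rule tensor_mat_mult_vec_index[OF E F swap_middle_carrier ij(1,2)])
  also have "\<dots> = (\<Sum>a<da. \<Sum>k<dA. \<Sum>b<db. \<Sum>l<dB. E $$ (i, a * dA + k) * F $$ (j, b * dB + l) *
      (\<Phi> $ (a * db + b) * \<Psi> $ (k * dB + l)))"
    unfolding sum_pair_index
    by (intro sum.cong refl) (simp add: resource_input_index[OF \<Phi> \<Psi>])
  also have "\<dots> = (\<Sum>a<da. \<Sum>k<dA. if k = i' then
      (\<Sum>b<db. E $$ (i, a * dA + i') * F $$ (j, b * dB + j') * \<Phi> $ (a * db + b)) else 0)"
  proof (intro sum.cong refl)
    fix a k assume k: "k \<in> {..<dA}"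
    have "(\<Sum>b<db. \<Sum>l<dB. E $$ (i, a * dA + k) * F $$ (j, b * dB + l) * (\<Phi> $ (a * db + b) * \<Psi> $ (k * dB + l)))
        = (\<Sum>b<db. \<Sum>l<dB. if l = j' then if k = i' then
             E $$ (i, a * dA + i') * F $$ (j, b * dB + j') * \<Phi> $ (a * db + b) else 0 else 0)"
      using k by (intro sum.cong refl) (simp add: \<Psi>_index)
    then show "(\<Sum>b<db. \<Sum>l<dB. E $$ (i, a * dA + k) * F $$ (j, b * dB + l) * (\<Phi> $ (a * db + b) * \<Psi> $ (k * dB + l)))
        = (if k = i' then (\<Sum>b<db. E $$ (i, a * dA + i') * F $$ (j, b * dB + j') * \<Phi> $ (a * db + b)) else 0)"
      using ij(4) by simp
  qed
  also have "\<dots> = (\<Sum>a<da. \<Sum>b<db. E $$ (i, a * dA + i') * F $$ (j, b * dB + j') * \<Phi> $ (a * db + b))"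
    using ij(3) by simp
  finally show ?thesis by (simp add: N_def)
qed

lemma unitary_columns_orthonormal:
  assumes "unitary_mat (dA * dB) U"
  shows "orthonormal_on {..<dA * dB} (dA * dB)
    (\<lambda>L K. U $$ (K div dB * dB + K mod dB, L div dB * dB + L mod dB))"
proof -
  have U: "U \<in> carrier_mat (dA * dB) (dA * dB)" "mat_adjoint U * U = 1\<^sub>m (dA * dB)"
    using assms by (auto simp: unitary_mat_def)
  have "(\<Sum>K<dA * dB. cnj (U $$ (K, P)) * U $$ (K, Q)) = (if P = Q then 1 else 0)"
    if "P < dA * dB" "Q < dA * dB" for P Q
    using mat_adjoint_mult_index[OF U(1) that] U(2) that by simp
  then show ?thesis by (simp add: orthonormal_on_def ip_def)
qed

lemma output_state_index:
  assumes U: "U \<in> carrier_mat (dA * dB) (dA * dB)"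
    and \<sigma>: "\<sigma> \<in> carrier_vec (dA * p)" and \<tau>: "\<tau> \<in> carrier_vec (dB * q)"
    and I: "I < dA * p" and J: "J < dB * q"
  shows "output_state dA dB p q U \<sigma> \<tau> $ (I * (dB * q) + J) =
    output_fun dA dB p q (\<lambda>i j k l. U $$ (i * dB + j, k * dB + l)) (\<lambda>i. \<sigma> $ i) (\<lambda>i. \<tau> $ i) (I, J)"
proof -
  define i x j y where "i = I div p" "x = I mod p" "j = J div q" "y = J mod q"
  note d = this
  have "p > 0" "q > 0" using I J by (auto intro: gr0I)
  then have b: "i < dA" "x < p" "j < dB" "y < q" using I J by (auto simp: d less_mult_imp_div_less)
  have IJ: "I = i * p + x" "J = j * q + y" by (simp_all add: d)
  let ?S = "swap_middle dA p dB q (tensor_vec \<sigma> \<tau>)"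
  have S: "?S \<in> carrier_vec (dA * dB * (p * q))" by (rule swap_middle_carrier)
  have "output_state dA dB p q U \<sigma> \<tau> $ (I * (dB * q) + J) =
      (tensor_mat U (1\<^sub>m (p * q)) *\<^sub>v ?S) $ ((i * dB + j) * (p * q) + (x * q + y))"
    unfolding output_state_def IJ swap_middle_index[OF b(1,3,2,4)] tensor_mat_one ..
  also have "\<dots> = (\<Sum>K<dA * dB. \<Sum>z<p * q. U $$ (i * dB + j, K) * 1\<^sub>m (p * q) $$ (x * q + y, z) * ?S $ (K * (p * q) + z))"
    by (rule tensor_mat_mult_vec_index[OF U one_carrier_mat S]) (use b in \<open>auto intro: pair_index_less\<close>)
  also have "\<dots> = (\<Sum>K<dA * dB. \<Sum>z<p * q. if z = x * q + y then U $$ (i * dB + j, K) * ?S $ (K * (p * q) + (x * q + y)) else 0)"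
    using pair_index_less[OF b(2,4)] by (intro sum.cong refl) auto
  also have "\<dots> = (\<Sum>K<dA * dB. U $$ (i * dB + j, K) * ?S $ (K * (p * q) + (x * q + y)))"
    using pair_index_less[OF b(2,4)] by simp
  also have "\<dots> = (\<Sum>k<dA. \<Sum>l<dB. U $$ (i * dB + j, k * dB + l) * (\<sigma> $ (k * p + x) * \<tau> $ (l * q + y)))"
    unfolding sum_pair_index using b
    by (intro sum.cong refl) (simp add: resource_input_index[OF \<sigma> \<tau>])
  finally show ?thesis by (simp add: output_fun_def d)
qed

section \<open>Separable generation in index form and its consequences\<close>

text \<open>Matrices become functions of their indices, so that the lemmas on finite families apply
  directly. \<open>generation\<close> speaks of basis inputs; product inputs with ancillas follow by
  linearity in \<open>output_expansion\<close>. \<open>isometry\<close> is the orthonormality of the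
  columns of \<open>U\<close>.\<close>

locale separable_generation =
  fixes da db dA dB M :: nat
    and E F :: "nat \<Rightarrow> nat \<Rightarrow> nat \<Rightarrow> complex" and c :: "nat \<Rightarrow> complex"
    and \<phi> :: "nat \<times> nat \<Rightarrow> complex" and u :: "nat \<Rightarrow> nat \<Rightarrow> nat \<Rightarrow> nat \<Rightarrow> complex"
  assumes completeness: "\<And>P P' Q Q'. P < da * dA \<Longrightarrow> P' < da * dA \<Longrightarrow> Q < db * dB \<Longrightarrow> Q' < db * dB \<Longrightarrow>
      (\<Sum>m<M. (\<Sum>i<dA. cnj (E m i P) * E m i P') * (\<Sum>j<dB. cnj (F m j Q) * F m j Q'))
      = (if P = P' \<and> Q = Q' then 1 else 0)"
    and generation: "\<And>m i j i' j'. m < M \<Longrightarrow> i < dA \<Longrightarrow> j < dB \<Longrightarrow> i' < dA \<Longrightarrow> j' < dB \<Longrightarrow>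
      c m * u i j i' j' = (\<Sum>a<da. \<Sum>b<db. E m i (a * dA + i') * F m j (b * dB + j') * \<phi> (a, b))"
    and isometry: "orthonormal_on {..<dA * dB} (dA * dB)
      (\<lambda>L K. u (K div dB) (K mod dB) (L div dB) (L mod dB))"
begin

lemma operator_expansion:
  assumes "\<And>a b. a < da \<Longrightarrow> b < db \<Longrightarrow> \<phi> (a, b) = (\<Sum>k<r. s k * (e k a * f k b))"
    and "m < M" "i < dA" "j < dB" "i' < dA" "j' < dB"
  shows "c m * u i j i' j' =
    (\<Sum>k<r. s k * (branch_op da dA (E m) (e k) i i' * branch_op db dB (F m) (f k) j j'))"
  unfolding generation[OF assms(2-)]
  by (rule branch_op_expand[where \<phi> = "\<lambda>a b. \<phi> (a, b)", OF assms(1)])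

lemma output_expansion:
  assumes "\<And>a b. a < da \<Longrightarrow> b < db \<Longrightarrow> \<phi> (a, b) = (\<Sum>k<r. s k * (e k a * f k b))"
    and "m < M" "I \<in> {..<dA * p}" "J \<in> {..<dB * q}"
  shows "c m * output_fun dA dB p q u \<sigma> \<tau> (I, J) =
    (\<Sum>k<r. s k * (branch_vec da dA p (E m) (e k) \<sigma> I * branch_vec db dB q (F m) (f k) \<tau> J))"
proof (rule branch_output)
  fix k l assume "k < dA" "l < dB"
  with assms(3,4) show "c m * u (I div p) (J div q) k l =
      (\<Sum>n<r. s n * (branch_op da dA (E m) (e n) (I div p) k * branch_op db dB (F m) (f n) (J div q) l))"
    by (intro operator_expansion[OF assms(1,2)]) (auto simp: less_mult_imp_div_less)
qed

context
  fixes r :: nat and s :: "nat \<Rightarrow> real" and e f :: "nat \<Rightarrow> nat \<Rightarrow> complex"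
  assumes e: "orthonormal_on {..<da} r e" and f: "orthonormal_on {..<db} r f"
    and \<phi>: "\<And>a b. a < da \<Longrightarrow> b < db \<Longrightarrow> \<phi> (a, b) = (\<Sum>k<r. complex_of_real (s k) * (e k a * f k b))"
    and \<phi>_norm: "nrm2 ({..<da} \<times> {..<db}) \<phi> = 1"
begin

lemma resource_weights: "(\<Sum>k<r. (s k)\<^sup>2) = 1"
  using nrm2_schmidt[where om = \<phi> and t = s, OF e f \<phi>] \<phi>_norm by simp

text \<open>If all \<open>c m\<close> vanished, conservation of norm would make the total weight of
  the resource 0 instead of 1.\<close>

lemma branch_nonzero:
  assumes "dA > 0" "dB > 0"
  shows "\<exists>m<M. c m \<noteq> 0"
proof (rule ccontr)
  assume "\<not> (\<exists>m<M. c m \<noteq> 0)"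
  \<comment> \<open>The test input is the first basis vector on each side, with ancillas of
    dimension 1; positive dimension makes it a unit vector.\<close>
  define \<delta> where "\<delta> = (\<lambda>i::nat. if i = 0 then 1 else 0 :: complex)"
  have n: "nrm2 {..<d * 1} \<delta> = 1" if "d > 0" for d
  proof -
    have "nrm2 {..<d * 1} \<delta> = (\<Sum>i<d. if i = 0 then 1 else 0)"
      unfolding nrm2_def \<delta>_def by (intro sum.cong) auto
    then show ?thesis using that by simp
  qed
  have "(\<Sum>m<M. (cmod (c m))\<^sup>2) * nrm2 ({..<dA * 1} \<times> {..<dB * 1}) (output_fun dA dB 1 1 u \<delta> \<delta>) = (\<Sum>k<r. (s k)\<^sup>2)"
    by (rule sum_branch_weights[OF output_expansion[OF \<phi>]
          branch_gram[OF completeness e f n[OF assms(1)] n[OF assms(2)]]])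
  with \<open>\<not> (\<exists>m<M. c m \<noteq> 0)\<close> show False by (simp add: resource_weights)
qed

text \<open>Majorization is available at every threshold, so \<open>entropy_le_of_hinge\<close>
  applies to the squared coefficients; those of the output sum to 1 because \<open>U\<close>
  preserves the norm.\<close>

lemma entropy_bound:
  assumes s: "\<And>k. k < r \<Longrightarrow> s k > 0" and t: "\<And>l. l < d \<Longrightarrow> t l > 0"
    and \<sigma>: "nrm2 {..<dA * p} \<sigma> = 1" and \<tau>: "nrm2 {..<dB * q} \<tau> = 1"
    and g: "orthonormal_on {..<dA * p} d g" and h: "orthonormal_on {..<dB * q} d h"
    and om: "\<And>I J. I \<in> {..<dA * p} \<Longrightarrow> J \<in> {..<dB * q} \<Longrightarrow>
      output_fun dA dB p q u \<sigma> \<tau> (I, J) = (\<Sum>l<d. complex_of_real (t l) * (g l I * h l J))"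
  shows "- (\<Sum>l<d. (t l)\<^sup>2 * ln ((t l)\<^sup>2)) \<le> - (\<Sum>k<r. (s k)\<^sup>2 * ln ((s k)\<^sup>2))"
proof -
  have t1: "(\<Sum>l<d. (t l)\<^sup>2) = 1"
    using nrm2_schmidt[where om = "output_fun dA dB p q u \<sigma> \<tau>" and t = t, OF g h om]
      nrm2_output_fun[OF isometry \<sigma> \<tau>] by simp
  have "(\<Sum>k<r. max 0 ((s k)\<^sup>2 - \<theta>)) \<le> (\<Sum>l<d. max 0 ((t l)\<^sup>2 - \<theta>))" if "\<theta> \<ge> 0" for \<theta>
    by (rule schmidt_majorization[OF finite_lessThan finite_lessThan g h that om
          output_expansion[OF \<phi>] branch_gram[OF completeness e f \<sigma> \<tau>] t1 resource_weights])
  then have "(\<Sum>k<r. (s k)\<^sup>2 * ln ((s k)\<^sup>2)) \<le> (\<Sum>l<d. (t l)\<^sup>2 * ln ((t l)\<^sup>2))"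
    by (intro entropy_le_of_hinge zero_less_power s t t1 resource_weights)
  then show ?thesis by simp
qed

end

end

section \<open>Passage to the index form, and expansions realizing or bounding Schmidt ranks\<close>

lemma generated_by_separableE:
  assumes "generated_by_separable da db dA dB \<Phi> U" "unitary_mat (dA * dB) U" "\<Phi> \<in> carrier_vec (da * db)"
  obtains M E F c where "separable_generation da db dA dB M E F c
    (\<lambda>(a, b). \<Phi> $ (a * db + b)) (\<lambda>i j k l. U $$ (i * dB + j, k * dB + l))"
proof -
  from assms(1) obtain M E F and c :: "nat \<Rightarrow> complex" where
    EF: "\<forall>m<M. E m \<in> carrier_mat dA (da * dA) \<and> F m \<in> carrier_mat dB (db * dB)" and
    comp: "mat_sum (da * dA * (db * dB)) (da * dA * (db * dB))
          (\<lambda>m. tensor_mat (mat_adjoint (E m) * E m) (mat_adjoint (F m) * F m)) {..<M}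
          = tensor_mat (1\<^sub>m (da * dA)) (1\<^sub>m (db * dB))" and
    gen: "\<forall>m<M. \<forall>\<Psi>\<in>carrier_vec (dA * dB).
           tensor_mat (E m) (F m) *\<^sub>v swap_middle da db dA dB (tensor_vec \<Phi> \<Psi>)
           = c m \<cdot>\<^sub>v (U *\<^sub>v \<Psi>)"
    unfolding generated_by_separable_def by blast
  have c: "E m \<in> carrier_mat dA (da * dA)" "F m \<in> carrier_mat dB (db * dB)" if "m < M" for m
    using EF that by auto
  have U: "U \<in> carrier_mat (dA * dB) (dA * dB)" using assms(2) by (simp add: unitary_mat_def)
  have "separable_generation da db dA dB M (\<lambda>m i P. E m $$ (i, P)) (\<lambda>m i P. F m $$ (i, P)) c
    (\<lambda>(a, b). \<Phi> $ (a * db + b)) (\<lambda>i j k l. U $$ (i * dB + j, k * dB + l))"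
  proof
    fix P P' Q Q' assume P: "P < da * dA" "P' < da * dA" and Q: "Q < db * dB" "Q' < db * dB"
    have "(\<Sum>m<M. tensor_mat (mat_adjoint (E m) * E m) (mat_adjoint (F m) * F m) $$
        (P * (db * dB) + Q, P' * (db * dB) + Q')) =
      tensor_mat (1\<^sub>m (da * dA)) (1\<^sub>m (db * dB)) $$ (P * (db * dB) + Q, P' * (db * dB) + Q')"
      unfolding comp[symmetric] using pair_index_less[OF P(1) Q(1)] pair_index_less[OF P(2) Q(2)]
      by (simp add: mat_sum_def)
    also have "\<dots> = (if P = P' \<and> Q = Q' then 1 else 0)"
      using P Q by (subst tensor_mat_index[OF one_carrier_mat one_carrier_mat]) auto
    finally show "(\<Sum>m<M. (\<Sum>i<dA. cnj (E m $$ (i, P)) * E m $$ (i, P')) *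
        (\<Sum>j<dB. cnj (F m $$ (j, Q)) * F m $$ (j, Q'))) = (if P = P' \<and> Q = Q' then 1 else 0)"
      using P Q
      by (simp add: tensor_mat_index[OF mat_adjoint_mult_carrier[OF c(1)] mat_adjoint_mult_carrier[OF c(2)]]
          mat_adjoint_mult_index[OF c(1)] mat_adjoint_mult_index[OF c(2)])
  next
    fix m i j i' j' assume m: "m < M" and ij: "i < dA" "j < dB" "i' < dA" "j' < dB"
    show "c m * U $$ (i * dB + j, i' * dB + j') = (\<Sum>a<da. \<Sum>b<db. E m $$ (i, a * dA + i') *
        F m $$ (j, b * dB + j') * (case (a, b) of (a, b) \<Rightarrow> \<Phi> $ (a * db + b)))"
      using separable_branch_index[OF U assms(3) c(1)[OF m] c(2)[OF m] gen[rule_format, OF m] ij] by simp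
  qed (rule unitary_columns_orthonormal[OF assms(2)])
  then show ?thesis by (rule that)
qed

text \<open>The minimum defining the rank is attained once some product expansion exists; the
  Schmidt decomposition is one, its coefficients being absorbed into the left factors.\<close>

lemma schmidt_rank_state_decomposition:
  assumes "\<psi> \<in> carrier_vec (n * m)"
  shows "\<exists>v w. \<forall>i<n. \<forall>j<m. \<psi> $ (i * m + j) = (\<Sum>k<schmidt_rank_state n m \<psi>. v k i * w k j)"
proof -
  let ?P = "\<lambda>r. \<exists>v w. (\<forall>j<r. v j \<in> carrier_vec n \<and> w j \<in> carrier_vec m) \<and>
        \<psi> = finsum_vec TYPE(complex) (n * m) (\<lambda>j. tensor_vec (v j) (w j)) {..<r}"
  have tensor_index: "finsum_vec TYPE(complex) (n * m) (\<lambda>j. tensor_vec (v j) (w j)) {..<r} $ (i * m + l)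
      = (\<Sum>j<r. v j $ i * w j $ l)"
    if "\<forall>j<r. v j \<in> carrier_vec n \<and> w j \<in> carrier_vec m" "i < n" "l < m" for v w i l and r :: nat
    using finsum_tensor_index[of "{..<r}" v n w m i l "\<lambda>_. 1"] that by simp
  obtain s e f where sd: "schmidt_decomposition n m \<psi> s e f"
    using schmidt_decomposition_exists[OF assms] by blast
  define v where "v = (\<lambda>k. complex_of_real (s ! k) \<cdot>\<^sub>v e ! k)"
  have c: "e ! k \<in> carrier_vec n" "f ! k \<in> carrier_vec m" if "k < length s" for k
    using sd that by (auto simp: schmidt_decomposition_def orthonormal_list_def subset_iff)
  have vf: "\<forall>k<length s. v k \<in> carrier_vec n \<and> f ! k \<in> carrier_vec m" using c by (simp add: v_def)
  have "\<psi> = finsum_vec TYPE(complex) (n * m) (\<lambda>j. tensor_vec (v j) (f ! j)) {..<length s}"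
  proof (rule vec_eq_pair_index[OF assms])
    show "finsum_vec TYPE(complex) (n * m) (\<lambda>j. tensor_vec (v j) (f ! j)) {..<length s} \<in> carrier_vec (n * m)"
      using vf by (intro finsum_vec_closed) (auto intro: tensor_vec_carrier)
    fix i l assume il: "i < n" "l < m"
    have "(\<Sum>k<length s. v k $ i * f ! k $ l) =
        (\<Sum>k<length s. complex_of_real (s ! k) * (e ! k $ i * f ! k $ l))"
      using il by (intro sum.cong refl) (simp add: v_def carrier_vecD[OF c(1)])
    then show "\<psi> $ (i * m + l) = finsum_vec TYPE(complex) (n * m) (\<lambda>j. tensor_vec (v j) (f ! j)) {..<length s} $ (i * m + l)"
      by (simp add: tensor_index[OF vf il] schmidt_decompositionD(4)[OF sd il])
  qed
  with vf have "?P (length s)" by (intro exI[of _ v] exI[of _ "(!) f"]) simp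
  then have "?P (schmidt_rank_state n m \<psi>)" unfolding schmidt_rank_state_def by (rule LeastI)
  then obtain v w where vw: "\<forall>j<schmidt_rank_state n m \<psi>. v j \<in> carrier_vec n \<and> w j \<in> carrier_vec m"
    and \<psi>: "\<psi> = finsum_vec TYPE(complex) (n * m) (\<lambda>j. tensor_vec (v j) (w j)) {..<schmidt_rank_state n m \<psi>}"
    by blast
  have "\<psi> $ (i * m + l) = (\<Sum>k<schmidt_rank_state n m \<psi>. v k $ i * w k $ l)" if "i < n" "l < m" for i l
    using tensor_index[OF vw that] by (subst \<psi>) simp
  then show ?thesis by (intro exI[of _ "\<lambda>k i. v k $ i"] exI[of _ "\<lambda>k i. w k $ i"]) simp
qed

lemma schmidt_rank_op_le:
  assumes U: "U \<in> carrier_mat (dA * dB) (dA * dB)"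
    and exp: "\<And>i j i' j'. i < dA \<Longrightarrow> j < dB \<Longrightarrow> i' < dA \<Longrightarrow> j' < dB \<Longrightarrow>
      U $$ (i * dB + j, i' * dB + j') = (\<Sum>k<r. a k i i' * b k j j')"
  shows "schmidt_rank_op dA dB U \<le> r"
proof -
  define A where "A = (\<lambda>k::nat. mat dA dA (\<lambda>(i, i'). a k i i'))"
  define B where "B = (\<lambda>k::nat. mat dB dB (\<lambda>(j, j'). b k j j'))"
  have AB: "A k \<in> carrier_mat dA dA" "B k \<in> carrier_mat dB dB" for k by (auto simp: A_def B_def)
  have "U = mat_sum (dA * dB) (dA * dB) (\<lambda>j. tensor_mat (A j) (B j)) {..<r}"
  proof (rule eq_matI)
    fix I J assume "I < dim_row (mat_sum (dA * dB) (dA * dB) (\<lambda>j. tensor_mat (A j) (B j)) {..<r})"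
      "J < dim_col (mat_sum (dA * dB) (dA * dB) (\<lambda>j. tensor_mat (A j) (B j)) {..<r})"
    then have IJ: "I < dA * dB" "J < dA * dB" by (auto simp: mat_sum_def)
    then have "dB > 0" by (auto intro: gr0I)
    then have d: "I div dB < dA" "I mod dB < dB" "J div dB < dA" "J mod dB < dB"
      using IJ by (auto simp: less_mult_imp_div_less)
    have "U $$ (I, J) = (\<Sum>k<r. a k (I div dB) (J div dB) * b k (I mod dB) (J mod dB))"
      using exp[OF d] by simp
    also have "\<dots> = (\<Sum>k<r. tensor_mat (A k) (B k) $$ (I div dB * dB + I mod dB, J div dB * dB + J mod dB))"
      by (intro sum.cong refl) (subst tensor_mat_index[OF AB d(1,2,3,4)], use d in \<open>simp add: A_def B_def\<close>)
    finally show "U $$ (I, J) = mat_sum (dA * dB) (dA * dB) (\<lambda>j. tensor_mat (A j) (B j)) {..<r} $$ (I, J)"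
      using IJ by (simp add: mat_sum_def)
  qed (use U in \<open>auto simp: mat_sum_def\<close>)
  then show ?thesis unfolding schmidt_rank_op_def using AB by (intro Least_le exI[of _ A] exI[of _ B]) auto
qed

lemma normalized_state_pair_nrm2:
  assumes "normalized_state (n * m) \<psi>"
  shows "nrm2 ({..<n} \<times> {..<m}) (\<lambda>(a, b). \<psi> $ (a * m + b)) = 1"
  using normalized_state_nrm2[OF assms]
  by (simp add: nrm2_def sum_pair_index sum.cartesian_product case_prod_unfold)

theorem theorem2:
  fixes dA dB da db :: nat
    and U :: "complex mat" and \<Phi> :: "complex vec"
  assumes "unitary_mat (dA * dB) U"
    and "normalized_state (da * db) \<Phi>"
    and "generated_by_separable da db dA dB \<Phi> U"
  shows "schmidt_rank_state da db \<Phi> \<ge> schmidt_rank_op dA dB U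
       \<and> ereal (entanglement da db \<Phi>) \<ge> entangling_strength dA dB U"
proof -
  have \<Phi>: "\<Phi> \<in> carrier_vec (da * db)" using assms(2) by (simp add: normalized_state_def)
  have U: "U \<in> carrier_mat (dA * dB) (dA * dB)" using assms(1) by (simp add: unitary_mat_def)
  obtain M E F c where "separable_generation da db dA dB M E F c
    (\<lambda>(a, b). \<Phi> $ (a * db + b)) (\<lambda>i j k l. U $$ (i * dB + j, k * dB + l))"
    using generated_by_separableE[OF assms(3,1) \<Phi>] .
  then interpret separable_generation da db dA dB M E F c
    "\<lambda>(a, b). \<Phi> $ (a * db + b)" "\<lambda>i j k l. U $$ (i * dB + j, k * dB + l)" .
  let ?s = "schmidt_coeffs da db \<Phi>"
  obtain e f where sd: "schmidt_decomposition da db \<Phi> ?s e f"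
    using schmidt_coeffs_decomposition[OF \<Phi>] by blast
  have \<Phi>_sd: "(case (a, b) of (a, b) \<Rightarrow> \<Phi> $ (a * db + b)) =
      (\<Sum>k<length ?s. complex_of_real (?s ! k) * (e ! k $ a * f ! k $ b))" if "a < da" "b < db" for a b
    using schmidt_decompositionD(4)[OF sd that] by simp
  \<comment> \<open>The four facts stand in the order of the assumptions on the resource under which
    \<open>branch_nonzero\<close> and \<open>entropy_bound\<close> were proved.\<close>
  note resource = schmidt_decompositionD(1,2)[OF sd] \<Phi>_sd normalized_state_pair_nrm2[OF assms(2)]
  have rank: "schmidt_rank_op dA dB U \<le> schmidt_rank_state da db \<Phi>"
  proof (cases "dA > 0 \<and> dB > 0")
    case True
    obtain m where m: "m < M" "c m \<noteq> 0" using branch_nonzero[OF resource] True by blast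
    \<comment> \<open>A product expansion of minimal length is pushed through the branch
      \<open>m\<close>; the division by \<open>c m\<close> then goes into the left factors.\<close>
    obtain v w where vw: "\<forall>a<da. \<forall>b<db. \<Phi> $ (a * db + b) = (\<Sum>k<schmidt_rank_state da db \<Phi>. v k a * w k b)"
      using schmidt_rank_state_decomposition[OF \<Phi>] by blast
    show ?thesis
    proof (rule schmidt_rank_op_le[OF U])
      fix i j i' j' assume ij: "i < dA" "j < dB" "i' < dA" "j' < dB"
      have "c m * U $$ (i * dB + j, i' * dB + j') =
        (\<Sum>k<schmidt_rank_state da db \<Phi>. 1 * (branch_op da dA (E m) (v k) i i' * branch_op db dB (F m) (w k) j j'))"
        by (rule operator_expansion[OF _ m(1) ij]) (use vw in simp)
      then show "U $$ (i * dB + j, i' * dB + j') = (\<Sum>k<schmidt_rank_state da db \<Phi>.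
          branch_op da dA (E m) (v k) i i' / c m * branch_op db dB (F m) (w k) j j')"
        using m(2) by (simp add: field_simps flip: sum_divide_distrib)
    qed
  next
    \<comment> \<open>If a local dimension is 0, \<open>U\<close> has no entries and the empty
      expansion shows that its rank is 0.\<close>
    case False
    then have "schmidt_rank_op dA dB U \<le> 0" by (intro schmidt_rank_op_le[OF U]) auto
    then show ?thesis by simp
  qed
  have "entangling_strength dA dB U \<le> ereal (entanglement da db \<Phi>)"
    unfolding entangling_strength_def
  proof (rule Sup_least, clarsimp)
    fix p q \<sigma> \<tau> assume n: "normalized_state (dA * p) \<sigma>" "normalized_state (dB * q) \<tau>"
    let ?\<omega> = "output_state dA dB p q U \<sigma> \<tau>"
    let ?t = "schmidt_coeffs (dA * p) (dB * q) ?\<omega>"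
    have "?\<omega> \<in> carrier_vec (dA * p * (dB * q))" unfolding output_state_def by (rule swap_middle_carrier)
    then obtain g h where sd': "schmidt_decomposition (dA * p) (dB * q) ?\<omega> ?t g h"
      using schmidt_coeffs_decomposition by blast
    have c: "\<sigma> \<in> carrier_vec (dA * p)" "\<tau> \<in> carrier_vec (dB * q)"
      using n by (auto simp: normalized_state_def)
    \<comment> \<open>Both entanglements are evaluated on the decompositions chosen by
      \<open>schmidt_coeffs\<close>; what remains to be shown is the expansion of the output in
      coordinates.\<close>
    show "entanglement (dA * p) (dB * q) ?\<omega> \<le> entanglement da db \<Phi>"
      unfolding entanglement_eq
    proof (rule entropy_bound[OF resource schmidt_decompositionD(3)[OF sd] schmidt_decompositionD(3)[OF sd']
          normalized_state_nrm2[OF n(1)] normalized_state_nrm2[OF n(2)] schmidt_decompositionD(1,2)[OF sd']])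
      fix I J assume "I \<in> {..<dA * p}" "J \<in> {..<dB * q}"
      then have IJ: "I < dA * p" "J < dB * q" by auto
      show "output_fun dA dB p q (\<lambda>i j k l. U $$ (i * dB + j, k * dB + l)) (\<lambda>i. \<sigma> $ i) (\<lambda>i. \<tau> $ i) (I, J) =
          (\<Sum>l<length ?t. complex_of_real (?t ! l) * (g ! l $ I * h ! l $ J))"
        unfolding output_state_index[OF U c IJ, symmetric] by (rule schmidt_decompositionD(4)[OF sd' IJ])
    qed
  qed
  with rank show ?thesis by simp
qed

end
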